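(* Let $\psi\in L^2(\mathbb R)$. Assume that $\widehat\psi$ is bounded and compactly supported, and let $I\subset\mathbb R$ be a finite interval, of length $|I|$, such that $\operatorname{supp}\widehat\psi\subseteq I$. Assume that there exist constants $C,D>0$ and $\alpha,\beta>0$ and a neighborhood $U$ of $0\in\mathbb R$ such that $$C\,|\gamma|^\beta\le|\widehat\psi(\gamma)|\le D\,|\gamma|^\alpha,\qquad \gamma\in U.$$ Fix any $a>1$ and any $b\in\,]0,|I|^{-1}]$, and for $j\in\mathbb Z$ let $$V_j=\overline{\operatorname{span}}\{D_{a^j}T_{kb}\psi\}_{k\in\mathbb Z}\subseteq L^2(\mathbb R).$$ Fix any $N\in\mathbb N$. Then the $N$ collections of subspaces $$\{V_{Nj}\}_{j\in\mathbb Z},\ \{V_{Nj+1}\}_{j\in\mathbb Z},\ \dots,\ \{V_{Nj+N-1}\}_{j\in\mathbb Z}$$ are woven information packets in $L^2(\mathbb R)$.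
   Context: Fourier transform: $\widehat f(\gamma)=\int_{-\infty}^\infty f(x)e^{-2\pi i x\gamma}\,dx$ for $f \in L^1(\mathbb R)\cap L^2(\mathbb R)$, extended unitarily to $L^2(\mathbb R)$; pointwise conditions on $\widehat\psi$ are understood almost everywhere. Operators on $L^2(\mathbb R)$: for $c>0$, $D_cf(x):=c^{1/2}f(cx)$; for $b\in\mathbb R$, $T_bf(x):=f(x-b)$. The notation $\overline{\operatorname{span}}$ denotes the closed linear span. Information packet: a family $\{W_j\}_{j\in J}$ of closed subspaces of a Hilbert space $\mathcal H$ is an information packet if each $f\in\mathcal H$ has an unconditionally convergent expansion $f=\sum_{j\in J}f_j$ with $f_j\in W_j$ for all $j\in J$. Woven: $N$ information packets $\{W_j^{(\ell)}\}_{j\in J}$, $\ell=1,\dots,N$, are woven if for each partition $\{\sigma_k\}_{k=1}^N$ of $J$ (parts may be empty), the family $\{W_j^{(1)}\}_{j\in\sigma_1}\cup\cdots\cup\{W_j^{(N)}\}_{j\in\sigma_N}$ is an information packet. Equivalently, for every choice of $\ell_j\in\{1,\dots,N\}$, $j\in J$, the family $\{W_j^{(\ell_j)}\}_{j\in J}$ is an information packet. In the claim, $J=\mathbb Z$ and $W_j^{(\ell)}=V_{Nj+\ell-1}$. *)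

theory Defs
  imports "HOL-Analysis.Analysis"
begin

section \<open>Complex Hilbert spaces and information packets\<close>

text \<open>
  The complex structure is put on top of \<^class>\<open>real_inner\<close>, whose real inner product is the real
  part of the complex one; norm, topology and completeness are thus the library's.
  The complex inner product is linear in its first argument.
\<close>

class complex_hilbert = real_inner + complete_space +
  fixes scaleC :: "complex \<Rightarrow> 'a \<Rightarrow> 'a"  (infixr "*\<^sub>C" 75)
    and cinner :: "'a \<Rightarrow> 'a \<Rightarrow> complex"
  assumes scaleC_add_right: "c *\<^sub>C (x + y) = c *\<^sub>C x + c *\<^sub>C y"
    and scaleC_add_left: "(c + d) *\<^sub>C x = c *\<^sub>C x + d *\<^sub>C x"
    and scaleC_scaleC: "c *\<^sub>C d *\<^sub>C x = (c * d) *\<^sub>C x"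
    and scaleC_one: "1 *\<^sub>C x = x"
    and scaleR_scaleC: "r *\<^sub>R x = complex_of_real r *\<^sub>C x"
    and cinner_commute: "cinner x y = cnj (cinner y x)"
    and cinner_add_left: "cinner (x + y) z = cinner x z + cinner y z"
    and cinner_scaleC_left: "cinner (c *\<^sub>C x) y = c * cinner x y"
    and inner_eq_Re_cinner: "inner x y = Re (cinner x y)"

instance complex_hilbert \<subseteq> banach ..

global_interpretation complex_vector:
  vector_space "scaleC :: complex \<Rightarrow> 'a \<Rightarrow> 'a::complex_hilbert"
  defines csubspace = complex_vector.subspace
    and cspan = complex_vector.span
  by unfold_locales
    (simp_all add: scaleC_add_right scaleC_add_left scaleC_scaleC scaleC_one)

definition unitary :: "('a::complex_hilbert \<Rightarrow> 'b::complex_hilbert) \<Rightarrow> bool" where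
  "unitary F \<longleftrightarrow> Vector_Spaces.linear scaleC scaleC F \<and> surj F \<and>
     (\<forall>x y. cinner (F x) (F y) = cinner x y)"

text \<open>
  \<^const>\<open>has_sum\<close> is convergence of the net of finite partial sums, i.e. unconditional convergence.
\<close>

definition information_packet :: "'j set \<Rightarrow> ('j \<Rightarrow> 'h::complex_hilbert set) \<Rightarrow> bool" where
  "information_packet J W \<longleftrightarrow>
     (\<forall>j\<in>J. csubspace (W j) \<and> closed (W j)) \<and>
     (\<forall>f. \<exists>g. (\<forall>j\<in>J. g j \<in> W j) \<and> (g has_sum f) J)"

text \<open>
  The packets are numbered \<open>1, \<dots>, N\<close>. The union of the families \<open>(W k j)\<close>, \<open>j \<in> \<sigma> k\<close>, is a union
  of indexed families, hence indexed by the pairs \<open>(k, j)\<close> with \<open>j \<in> \<sigma> k\<close>. The parts of the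
  partition may be empty.
\<close>

definition woven :: "nat \<Rightarrow> 'j set \<Rightarrow> (nat \<Rightarrow> 'j \<Rightarrow> 'h::complex_hilbert set) \<Rightarrow> bool" where
  "woven N J W \<longleftrightarrow>
     (\<forall>l\<in>{1..N}. information_packet J (W l)) \<and>
     (\<forall>\<sigma>. (\<Union>k\<in>{1..N}. \<sigma> k) = J \<and> disjoint_family_on \<sigma> {1..N} \<longrightarrow>
        information_packet (SIGMA k:{1..N}. \<sigma> k) (\<lambda>(k, j). W k j))"


section \<open>The Hilbert space of square-integrable functions on the real line\<close>

definition square_integrable :: "(real \<Rightarrow> complex) \<Rightarrow> bool" where
  "square_integrable f \<longleftrightarrow>
     f \<in> borel_measurable lborel \<and> integrable lborel (\<lambda>x. (cmod (f x))\<^sup>2)"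

definition l2_rel :: "(real \<Rightarrow> complex) \<Rightarrow> (real \<Rightarrow> complex) \<Rightarrow> bool" where
  "l2_rel f g \<longleftrightarrow> square_integrable f \<and> square_integrable g \<and> (AE x in lborel. f x = g x)"

lemma square_integrable_measurable: "square_integrable f \<Longrightarrow> f \<in> borel_measurable borel"
  by (simp add: square_integrable_def)

lemma square_integrable_0: "square_integrable (\<lambda>_. 0)"
  by (simp add: square_integrable_def)

lemma square_integrable_add:
  assumes "square_integrable f" "square_integrable g"
  shows "square_integrable (\<lambda>x. f x + g x)"
proof -
  have [measurable]: "f \<in> borel_measurable borel" "g \<in> borel_measurable borel"
    using assms by (auto intro: square_integrable_measurable)
  have *: "(cmod (u + v))\<^sup>2 \<le> 2 * (cmod u)\<^sup>2 + 2 * (cmod v)\<^sup>2" for u v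
  proof -
    have "(cmod (u + v))\<^sup>2 \<le> (cmod u + cmod v)\<^sup>2"
      by (intro power_mono norm_triangle_ineq) auto
    also have "\<dots> \<le> 2 * (cmod u)\<^sup>2 + 2 * (cmod v)\<^sup>2"
      using sum_squares_bound[of "cmod u" "cmod v"] by (simp add: power2_sum)
    finally show ?thesis .
  qed
  have "integrable lborel (\<lambda>x. (cmod (f x + g x))\<^sup>2)"
    by (rule Bochner_Integration.integrable_bound
          [where f = "\<lambda>x. 2 * (cmod (f x))\<^sup>2 + 2 * (cmod (g x))\<^sup>2"])
      (use assms * in \<open>auto simp: square_integrable_def\<close>)
  then show ?thesis
    by (simp add: square_integrable_def)
qed

lemma square_integrable_cmult:
  assumes "square_integrable f"
  shows "square_integrable (\<lambda>x. c * f x)"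
  using assms borel_measurable_times[of "\<lambda>_. c" borel f]
  by (simp add: square_integrable_def norm_mult power_mult_distrib)

lemma integrable_mult_cnj:
  assumes "square_integrable f" "square_integrable g"
  shows "integrable lborel (\<lambda>x. f x * cnj (g x))"
proof -
  have [measurable]: "f \<in> borel_measurable borel" "g \<in> borel_measurable borel"
    using assms by (auto intro: square_integrable_measurable)
  have *: "cmod u * cmod v \<le> (cmod u)\<^sup>2 + (cmod v)\<^sup>2" for u v
    using sum_squares_bound[of "cmod u" "cmod v"]
      mult_nonneg_nonneg[OF norm_ge_zero norm_ge_zero, of u v] by linarith
  have [measurable]: "(\<lambda>x. cnj (g x)) \<in> borel_measurable borel"
    by (intro borel_measurable_continuous_on[where f = cnj] continuous_intros) auto
  show ?thesis
    by (rule Bochner_Integration.integrable_bound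
          [where f = "\<lambda>x. (cmod (f x))\<^sup>2 + (cmod (g x))\<^sup>2"])
      (use assms * in \<open>auto simp: square_integrable_def norm_mult\<close>)
qed

quotient_type l2 = "real \<Rightarrow> complex" / partial: l2_rel
proof (rule part_equivpI)
  show "\<exists>f. l2_rel f f"
    using square_integrable_0 by (auto simp: l2_rel_def)
  show "symp l2_rel"
    by (auto simp: symp_def l2_rel_def eq_commute)
  show "transp l2_rel"
    by (rule transpI) (auto simp: l2_rel_def elim: eventually_elim2)
qed

lemma l2_relD:
  assumes "l2_rel f g"
  shows "f \<in> borel_measurable borel" "g \<in> borel_measurable borel" "AE x in lborel. f x = g x"
  using assms by (auto simp: l2_rel_def square_integrable_def)

lemma integral_mult_cnj_cong:
  assumes "l2_rel f f'" "l2_rel g g'"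
  shows "(\<integral>x. f x * cnj (g x) \<partial>lborel) = (\<integral>x. f' x * cnj (g' x) \<partial>lborel)"
proof (rule integral_cong_AE)
  show "(\<lambda>x. f x * cnj (g x)) \<in> borel_measurable lborel"
    "(\<lambda>x. f' x * cnj (g' x)) \<in> borel_measurable lborel"
    using assms unfolding l2_rel_def
    by (blast intro: borel_measurable_integrable integrable_mult_cnj)+
  show "AE x in lborel. f x * cnj (g x) = f' x * cnj (g' x)"
    using assms by (auto simp: l2_rel_def elim: eventually_elim2)
qed

lemma integral_mult_cnj_commute:
  "(\<integral>x. f x * cnj (g x) \<partial>lborel) = cnj (\<integral>x. g x * cnj (f x) \<partial>lborel)"
  for f g :: "real \<Rightarrow> complex"
  using Bochner_Integration.integral_cnj[of lborel "\<lambda>x. g x * cnj (f x)"]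
  by (simp add: mult.commute)

instantiation l2 :: real_inner
begin

lift_definition zero_l2 :: l2 is "\<lambda>_. 0"
  by (simp add: l2_rel_def square_integrable_0)

lift_definition plus_l2 :: "l2 \<Rightarrow> l2 \<Rightarrow> l2" is "\<lambda>f g x. f x + g x"
  by (auto simp: l2_rel_def intro!: square_integrable_add elim: eventually_elim2)

lift_definition uminus_l2 :: "l2 \<Rightarrow> l2" is "\<lambda>f x. - f x"
  by (auto simp: l2_rel_def square_integrable_def)

lift_definition minus_l2 :: "l2 \<Rightarrow> l2 \<Rightarrow> l2" is "\<lambda>f g x. f x - g x"
  using square_integrable_add[of _ "\<lambda>x. - g x" for g]
  by (auto simp: l2_rel_def square_integrable_def elim: eventually_elim2)

lift_definition scaleR_l2 :: "real \<Rightarrow> l2 \<Rightarrow> l2" is "\<lambda>r f x. complex_of_real r * f x"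
  by (auto simp: l2_rel_def intro!: square_integrable_cmult)

lift_definition inner_l2 :: "l2 \<Rightarrow> l2 \<Rightarrow> real" is
  "\<lambda>f g. Re (\<integral>x. f x * cnj (g x) \<partial>lborel)"
  by (rule arg_cong[OF integral_mult_cnj_cong])

definition norm_l2 :: "l2 \<Rightarrow> real" where "norm_l2 f = sqrt (inner f f)"
definition dist_l2 :: "l2 \<Rightarrow> l2 \<Rightarrow> real" where "dist_l2 f g = norm (f - g)"
definition sgn_l2 :: "l2 \<Rightarrow> l2" where "sgn_l2 f = scaleR (inverse (norm f)) f"
definition uniformity_l2 :: "(l2 \<times> l2) filter" where
  "uniformity_l2 = (INF e\<in>{0 <..}. principal {(x, y). dist x y < e})"
definition open_l2 :: "l2 set \<Rightarrow> bool" where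
  "open_l2 U \<longleftrightarrow> (\<forall>x\<in>U. eventually (\<lambda>(x', y). x' = x \<longrightarrow> y \<in> U) uniformity)"

instance
proof
  fix f g h :: l2 and r s :: real
  show "f + g + h = f + (g + h)"
    by transfer (simp add: l2_rel_def square_integrable_add add.assoc)
  show "f + g = g + f"
    by transfer (simp add: l2_rel_def square_integrable_add add.commute)
  show "0 + f = f"
    by transfer (simp add: l2_rel_def)
  show "- f + f = 0"
    by transfer (simp add: l2_rel_def square_integrable_0)
  show "f - g = f + - g"
  proof transfer
    fix f g assume "l2_rel f f" "l2_rel g g"
    then have "square_integrable f" "square_integrable (\<lambda>x. - g x)"
      by (auto simp: l2_rel_def square_integrable_def)
    from square_integrable_add[OF this]
    show "l2_rel (\<lambda>x. f x - g x) (\<lambda>x. f x + - g x)"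
      by (simp add: l2_rel_def)
  qed
  show "r *\<^sub>R (f + g) = r *\<^sub>R f + r *\<^sub>R g"
    by transfer
      (simp add: l2_rel_def square_integrable_add square_integrable_cmult distrib_left)
  show "(r + s) *\<^sub>R f = r *\<^sub>R f + s *\<^sub>R f"
    by transfer (simp add: l2_rel_def square_integrable_add square_integrable_cmult distrib_right)
  show "r *\<^sub>R s *\<^sub>R f = (r * s) *\<^sub>R f"
    by transfer (auto simp: l2_rel_def mult.assoc intro!: square_integrable_cmult)
  show "1 *\<^sub>R f = f"
    by transfer (simp add: l2_rel_def)
  show "inner f g = inner g f"
    by transfer (subst integral_mult_cnj_commute, simp)
  show "inner (f + g) h = inner f h + inner g h"
    by transfer (simp add: l2_rel_def distrib_right integrable_mult_cnj)
  show "inner (r *\<^sub>R f) g = r * inner f g"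
    by transfer (simp add: mult.assoc)
  show "0 \<le> inner f f"
    by transfer (simp add: complex_norm_square[symmetric] del: of_real_power)
  show "inner f f = 0 \<longleftrightarrow> f = 0"
  proof transfer
    fix f assume f: "l2_rel f f"
    have "Re (\<integral>x. f x * cnj (f x) \<partial>lborel) = (\<integral>x. (cmod (f x))\<^sup>2 \<partial>lborel)"
      by (simp add: complex_norm_square[symmetric] del: of_real_power)
    also have "\<dots> = 0 \<longleftrightarrow> (AE x in lborel. (cmod (f x))\<^sup>2 = 0)"
      using f by (intro integral_nonneg_eq_0_iff_AE) (auto simp: l2_rel_def square_integrable_def)
    finally show "(Re (\<integral>x. f x * cnj (f x) \<partial>lborel) = 0) = l2_rel f (\<lambda>_. 0)"
      using f by (simp add: l2_rel_def square_integrable_0)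
  qed
qed (simp_all add: norm_l2_def dist_l2_def sgn_l2_def uniformity_l2_def open_l2_def)

end

lemma square_integrable_rep: "square_integrable (rep_l2 f)"
  using Quotient_rep_reflp[OF Quotient_l2, of f] by (simp add: l2_rel_def)

lemma abs_rep_l2: "abs_l2 (rep_l2 f) = f"
  by (rule Quotient_abs_rep[OF Quotient_l2])

lemma abs_l2_eq_iff:
  assumes "square_integrable f" "square_integrable g"
  shows "abs_l2 f = abs_l2 g \<longleftrightarrow> (AE x in lborel. f x = g x)"
  using Quotient_rel[OF Quotient_l2, of f g] assms by (auto simp: l2_rel_def)

lemma rep_abs_l2:
  assumes "square_integrable f"
  shows "AE x in lborel. rep_l2 (abs_l2 f) x = f x"
  using abs_l2_eq_iff[OF square_integrable_rep assms] abs_rep_l2 by blast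

lemma minus_abs_l2:
  assumes "square_integrable f" "square_integrable g"
  shows "abs_l2 f - abs_l2 g = abs_l2 (\<lambda>x. f x - g x)"
  using assms by (intro minus_l2.abs_eq) (auto simp: l2_rel_def)

lemma norm_abs_l2:
  assumes "square_integrable f"
  shows "norm (abs_l2 f) = sqrt (\<integral>x. (cmod (f x))\<^sup>2 \<partial>lborel)"
proof -
  have "inner (abs_l2 f) (abs_l2 f) = Re (\<integral>x. f x * cnj (f x) \<partial>lborel)"
    using assms by (intro inner_l2.abs_eq) (auto simp: l2_rel_def)
  then show ?thesis
    by (simp add: norm_l2_def complex_norm_square[symmetric] del: of_real_power)
qed

lemma nn_integral_eq_norm_l2:
  assumes "square_integrable f"
  shows "(\<integral>\<^sup>+x. ennreal ((cmod (f x))\<^sup>2) \<partial>lborel) = ennreal ((norm (abs_l2 f))\<^sup>2)"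
  using assms by (simp add: norm_abs_l2 square_integrable_def nn_integral_eq_integral)

lemma square_integrable_diff:
  assumes "square_integrable f" "square_integrable g"
  shows "square_integrable (\<lambda>x. f x - g x)"
proof -
  have "square_integrable (\<lambda>x. - g x)"
    using assms(2) by (simp add: square_integrable_def)
  from square_integrable_add[OF assms(1) this] show ?thesis
    by simp
qed

instance l2 :: complete_space
proof
  fix X :: "nat \<Rightarrow> l2" assume X: "Cauchy X"
  have "\<exists>r. strict_mono r \<and> (\<forall>k::nat. \<forall>m\<ge>r k. \<forall>n\<ge>r k. dist (X m) (X n) < (1/4)^k)"
  proof -
    have "\<exists>M. \<forall>m\<ge>M. \<forall>n\<ge>M. dist (X m) (X n) < (1/4)^k" for k :: nat
      using X by (intro metric_CauchyD) auto
    then obtain M where M: "\<And>k m n. m \<ge> M k \<Longrightarrow> n \<ge> M k \<Longrightarrow> dist (X m) (X n) < (1/4)^k"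
      by metis
    define r where "r k = (\<Sum>i\<le>k. Suc (M i))" for k
    have "strict_mono r"
      by (simp add: strict_mono_Suc_iff r_def)
    moreover have "M k \<le> r k" for k
    proof -
      have "Suc (M k) \<le> r k"
        unfolding r_def by (rule member_le_sum) auto
      then show ?thesis by simp
    qed
    ultimately show ?thesis
      using M order.trans by blast
  qed
  then obtain r where r: "strict_mono r"
    and X_r: "\<And>k m n. r k \<le> m \<Longrightarrow> r k \<le> n \<Longrightarrow> dist (X m) (X n) < (1/4)^k"
    by blast
  define h where "h k = rep_l2 (X (r k))" for k
  have sq: "square_integrable (h k)" for k
    by (simp add: h_def square_integrable_rep)
  then have [measurable]: "h k \<in> borel_measurable borel" for k
    by (rule square_integrable_measurable)
  have abs_h: "abs_l2 (h k) = X (r k)" for k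
    by (simp add: h_def abs_rep_l2)
  have nn_diff: "(\<integral>\<^sup>+x. ennreal ((cmod (h m x - h n x))\<^sup>2) \<partial>lborel) \<le> ennreal (((1/4)^k)\<^sup>2)"
    if "k \<le> m" "k \<le> n" for k m n
  proof -
    have "dist (X (r m)) (X (r n)) < (1/4)^k"
      using that r by (intro X_r) (auto simp: strict_mono_less_eq)
    then have "norm (abs_l2 (\<lambda>x. h m x - h n x)) \<le> (1/4)^k"
      using sq by (simp add: dist_norm abs_h[symmetric] minus_abs_l2)
    then show ?thesis
      using sq by (subst nn_integral_eq_norm_l2) (auto intro!: ennreal_leI power_mono
        square_integrable_diff)
  qed
  define f where "f x = lim (\<lambda>k. h k x)" for x
  have f_meas [measurable]: "f \<in> borel_measurable borel"
    unfolding f_def by measurable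
  have conv: "AE x in lborel. (\<lambda>k. h k x) \<longlonglongrightarrow> f x"
  proof -
    have "(\<integral>\<^sup>+x. (\<Sum>k. ennreal (4^k * (cmod (h (Suc k) x - h k x))\<^sup>2)) \<partial>lborel)
        = (\<Sum>k. \<integral>\<^sup>+x. ennreal (4^k * (cmod (h (Suc k) x - h k x))\<^sup>2) \<partial>lborel)"
      by (intro nn_integral_suminf) measurable
    also have "\<dots> = (\<Sum>k. ennreal (4^k) * (\<integral>\<^sup>+x. ennreal ((cmod (h (Suc k) x - h k x))\<^sup>2) \<partial>lborel))"
      by (intro suminf_cong, subst nn_integral_cmult[symmetric]) (auto simp: ennreal_mult)
    also have "\<dots> \<le> (\<Sum>k. ennreal (4^k) * ennreal (((1/4)^k)\<^sup>2))"
      by (intro suminf_le mult_left_mono nn_diff) auto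
    also have "\<dots> = (\<Sum>k. ennreal ((1/4)^k))"
    proof (intro suminf_cong)
      fix k :: nat
      have "(4::real)^k * ((1/4)^k)\<^sup>2 = (1/4)^k"
        by (simp add: power2_eq_square power_divide)
      then show "ennreal (4^k) * ennreal (((1/4)^k)\<^sup>2) = ennreal ((1/4)^k)"
        by (simp add: ennreal_mult[symmetric] del: ennreal_power)
    qed
    also have "\<dots> < \<infinity>"
      by (subst suminf_ennreal2) (auto simp: summable_geometric)
    finally have "AE x in lborel. (\<Sum>k. ennreal (4^k * (cmod (h (Suc k) x - h k x))\<^sup>2)) \<noteq> \<infinity>"
      by (intro nn_integral_noteq_infinite) auto
    then show ?thesis
    proof eventually_elim
      fix x assume x: "(\<Sum>k. ennreal (4^k * (cmod (h (Suc k) x - h k x))\<^sup>2)) \<noteq> \<infinity>"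
      have "summable (\<lambda>k. 4^k * (cmod (h (Suc k) x - h k x))\<^sup>2)"
        using x by (intro summable_suminf_not_top) auto
      then have "Bseq (\<lambda>k. 4^k * (cmod (h (Suc k) x - h k x))\<^sup>2)"
        by (intro convergent_imp_Bseq) (auto dest: summable_LIMSEQ_zero simp: convergent_def)
      then obtain K where K: "K > 0" "\<And>k. norm (4^k * (cmod (h (Suc k) x - h k x))\<^sup>2) \<le> K"
        unfolding Bseq_def by blast
      have bd: "cmod (h (Suc k) x - h k x) \<le> sqrt K * (1/2)^k" for k
      proof -
        have "(2^k * cmod (h (Suc k) x - h k x))\<^sup>2 \<le> K"
          using K(2)[of k] power_mult_distrib[of "2::real" 2 k]
          by (simp add: power2_eq_square ac_simps)
        then have "2^k * cmod (h (Suc k) x - h k x) \<le> sqrt K"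
          by (intro real_le_rsqrt)
        then show ?thesis
          by (simp add: power_divide field_simps)
      qed
      have "summable (\<lambda>k. h (Suc k) x - h k x)"
        by (rule summable_comparison_test'[where g = "\<lambda>k. sqrt K * (1/2)^k" and N = 0])
          (use bd in \<open>auto intro!: summable_mult summable_geometric\<close>)
      then have "convergent (\<lambda>n. \<Sum>k<n. h (Suc k) x - h k x)"
        by (simp add: summable_iff_convergent)
      then have "convergent (\<lambda>n. h n x - h 0 x)"
        by (simp add: sum_lessThan_telescope[of "\<lambda>n. h n x"])
      then have "convergent (\<lambda>n. (h n x - h 0 x) + h 0 x)"
        by (intro convergent_add convergent_const)
      then show "(\<lambda>k. h k x) \<longlonglongrightarrow> f x"
        by (simp add: f_def convergent_LIMSEQ_iff)
    qed
  qed
  have nn_f: "(\<integral>\<^sup>+x. ennreal ((cmod (f x - h k x))\<^sup>2) \<partial>lborel) \<le> ennreal (((1/4)^k)\<^sup>2)" for k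
  proof -
    have "(\<integral>\<^sup>+x. ennreal ((cmod (f x - h k x))\<^sup>2) \<partial>lborel)
        = (\<integral>\<^sup>+x. liminf (\<lambda>m. ennreal ((cmod (h m x - h k x))\<^sup>2)) \<partial>lborel)"
    proof (intro nn_integral_cong_AE, use conv in eventually_elim)
      fix x assume "(\<lambda>m. h m x) \<longlonglongrightarrow> f x"
      then have "(\<lambda>m. ennreal ((cmod (h m x - h k x))\<^sup>2)) \<longlonglongrightarrow> ennreal ((cmod (f x - h k x))\<^sup>2)"
        by (intro tendsto_intros tendsto_ennrealI)
      from lim_imp_Liminf[OF _ this]
      show "ennreal ((cmod (f x - h k x))\<^sup>2) = liminf (\<lambda>m. ennreal ((cmod (h m x - h k x))\<^sup>2))"
        by simp
    qed
    also have "\<dots> \<le> liminf (\<lambda>m. \<integral>\<^sup>+x. ennreal ((cmod (h m x - h k x))\<^sup>2) \<partial>lborel)"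
      by (intro nn_integral_liminf) measurable
    also have "\<dots> \<le> ennreal (((1/4)^k)\<^sup>2)"
      by (rule Liminf_le) (auto intro!: eventually_sequentiallyI[of k] nn_diff)
    finally show ?thesis .
  qed
  have sq_diff: "square_integrable (\<lambda>x. f x - h k x)" for k
    unfolding square_integrable_def integrable_iff_bounded
    using nn_f[of k] by (auto intro: le_less_trans)
  have sq_f: "square_integrable f"
    using square_integrable_add[OF sq_diff sq, of 0 0] by simp
  have dist_le: "dist (X (r k)) (abs_l2 f) \<le> (1/4)^k" for k
  proof -
    have "ennreal ((norm (abs_l2 (\<lambda>x. f x - h k x)))\<^sup>2) \<le> ennreal (((1/4)^k)\<^sup>2)"
      using nn_f[of k] by (simp add: nn_integral_eq_norm_l2[OF sq_diff])
    then have "norm (abs_l2 (\<lambda>x. f x - h k x)) \<le> (1/4)^k"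
      by (subst (asm) ennreal_le_iff) (auto intro: power2_le_imp_le)
    then show ?thesis
      by (simp add: dist_commute dist_norm minus_abs_l2[OF sq_f sq, symmetric] abs_h)
  qed
  have lim0: "(\<lambda>k. (1/4)^k :: real) \<longlonglongrightarrow> 0"
    by (rule LIMSEQ_power_zero) simp
  have "(\<lambda>k. dist (X (r k)) (abs_l2 f)) \<longlonglongrightarrow> 0"
    by (rule tendsto_sandwich[OF _ _ tendsto_const lim0]) (use dist_le in auto)
  then have "(\<lambda>k. X (r k)) \<longlonglongrightarrow> abs_l2 f"
    by (rule iffD2[OF tendsto_dist_iff])
  then have "X \<longlonglongrightarrow> abs_l2 f"
    using Cauchy_converges_subseq[OF X r] by (simp add: o_def)
  then show "convergent X"
    by (rule convergentI)
qed

instantiation l2 :: complex_hilbert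
begin

lift_definition scaleC_l2 :: "complex \<Rightarrow> l2 \<Rightarrow> l2" is "\<lambda>c f x. c * f x"
  by (auto simp: l2_rel_def intro!: square_integrable_cmult)

lift_definition cinner_l2 :: "l2 \<Rightarrow> l2 \<Rightarrow> complex" is "\<lambda>f g. \<integral>x. f x * cnj (g x) \<partial>lborel"
  by (rule integral_mult_cnj_cong)

instance
proof
  fix f g h :: l2 and c d :: complex and r :: real
  show "c *\<^sub>C (f + g) = c *\<^sub>C f + c *\<^sub>C g"
    by transfer
      (simp add: l2_rel_def square_integrable_add square_integrable_cmult distrib_left)
  show "(c + d) *\<^sub>C f = c *\<^sub>C f + d *\<^sub>C f"
    by transfer (auto simp: l2_rel_def distrib_right
      simp flip: distrib_right
      intro!: square_integrable_cmult)
  show "c *\<^sub>C d *\<^sub>C f = (c * d) *\<^sub>C f"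
    by transfer (auto simp: l2_rel_def mult.assoc intro!: square_integrable_cmult)
  show "1 *\<^sub>C f = f"
    by transfer (simp add: l2_rel_def)
  show "r *\<^sub>R f = complex_of_real r *\<^sub>C f"
    by transfer (simp add: l2_rel_def square_integrable_cmult)
  show "cinner f g = cnj (cinner g f)"
    by transfer (rule integral_mult_cnj_commute)
  show "cinner (f + g) h = cinner f h + cinner g h"
    by transfer (simp add: l2_rel_def distrib_right integrable_mult_cnj)
  show "cinner (c *\<^sub>C f) g = c * cinner f g"
    by transfer (simp add: mult.assoc)
  show "inner f g = Re (cinner f g)"
    by transfer simp
qed

end


section \<open>Dilation, translation and Fourier transform\<close>

lemma square_integrable_affine:
  assumes "square_integrable f" "c \<noteq> 0"
  shows "square_integrable (\<lambda>x. f (t + c * x))"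
proof -
  have [measurable]: "f \<in> borel_measurable borel"
    by (rule square_integrable_measurable) fact
  show ?thesis
    using assms lborel_integrable_real_affine[of "\<lambda>x. (cmod (f x))\<^sup>2" c t]
    by (simp add: square_integrable_def)
qed

lemma l2_rel_affine:
  assumes "l2_rel f g" "c \<noteq> 0"
  shows "l2_rel (\<lambda>x. f (t + c * x)) (\<lambda>x. g (t + c * x))"
proof -
  have [measurable]: "f \<in> borel_measurable borel" "g \<in> borel_measurable borel"
    using l2_relD[OF assms(1)] by auto
  show ?thesis
    using assms AE_borel_affine[of c "\<lambda>x. f x = g x" t]
    by (auto simp: l2_rel_def square_integrable_affine)
qed

text \<open>Only positive dilation parameters are meaningful.\<close>

lift_definition dilation :: "real \<Rightarrow> l2 \<Rightarrow> l2" is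
  "\<lambda>c f x. complex_of_real (sqrt c) * f (c * x)"
proof -
  fix c :: real and f g assume "l2_rel f g"
  then show "l2_rel (\<lambda>x. complex_of_real (sqrt c) * f (c * x))
      (\<lambda>x. complex_of_real (sqrt c) * g (c * x))"
    using l2_rel_affine[of f g c 0]
    by (cases "c = 0") (auto simp: l2_rel_def square_integrable_0 intro!: square_integrable_cmult)
qed

lift_definition translation :: "real \<Rightarrow> l2 \<Rightarrow> l2" is "\<lambda>b f x. f (x - b)"
proof -
  fix b :: real and f g assume "l2_rel f g"
  then show "l2_rel (\<lambda>x. f (x - b)) (\<lambda>x. g (x - b))"
    using l2_rel_affine[of f g 1 "- b"] by simp
qed

definition fourier_integral :: "(real \<Rightarrow> complex) \<Rightarrow> real \<Rightarrow> complex" where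
  "fourier_integral f \<gamma> =
     (\<integral>x. f x * exp (- 2 * complex_of_real pi * \<i> * complex_of_real (x * \<gamma>)) \<partial>lborel)"

text \<open>The unitary extension of the Fourier integral from the dense subspace of functions that are
  both integrable and square-integrable; existence is Plancherel's theorem, uniqueness is density.\<close>

definition fourier :: "l2 \<Rightarrow> l2" where
  "fourier = (THE F. unitary F \<and>
     (\<forall>f. integrable lborel f \<and> square_integrable f \<longrightarrow>
        (AE \<gamma> in lborel. rep_l2 (F (abs_l2 f)) \<gamma> = fourier_integral f \<gamma>)))"

text \<open>The support of a function given up to null sets: the complement of the largest open set on
  which it vanishes almost everywhere.\<close>

definition essential_support :: "(real \<Rightarrow> complex) \<Rightarrow> real set" where
  "essential_support f = - \<Union>{U. open U \<and> (AE x in lborel. x \<in> U \<longrightarrow> f x = 0)}"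

definition wavelet_space :: "real \<Rightarrow> real \<Rightarrow> l2 \<Rightarrow> int \<Rightarrow> l2 set" where
  "wavelet_space a b \<psi> j =
     closure (cspan (range (\<lambda>k::int. dilation (a powi j) (translation (of_int k * b) \<psi>))))"

end

theory Submission
  imports Defs "HOL-Probability.Sinc_Integral"
begin

text \<open>
  After a Fourier transform, \<open>V\<^sub>j\<close> is spanned by the functions \<open>e\<^sub>k \<cdot> \<Psi>\<close> on the scale \<open>a\<^sup>j\<close>, where \<open>\<Psi>\<close>
  is the transform of \<open>\<psi>\<close> dilated by \<open>a\<^sup>j\<close> and the \<open>e\<^sub>k\<close> are all exponentials of period \<open>a\<^sup>j / b\<close>.
  As \<open>\<Psi>\<close> lives on an interval no longer than this period, a function orthogonal to \<open>V\<^sub>j\<close> has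
  transform zero wherever \<open>\<Psi> \<noteq> 0\<close>, by uniqueness of Fourier coefficients. The lower bound near \<open>0\<close> makes \<open>\<Psi>\<close>
  nonzero on \<open>0 < \<bar>\<gamma>\<bar> < a\<^sup>j r\<close> for some \<open>r > 0\<close>, so \<open>V\<^sub>j\<close> contains every function whose transform is
  supported in \<open>\<bar>\<gamma>\<bar> < a\<^sup>j r\<close>. Cutting the transform of \<open>f\<close> into the annuli
  \<open>q\<^sup>i\<^sup>-\<^sup>1 r \<le> \<bar>\<gamma>\<bar> < q\<^sup>i r\<close> with \<open>q = a\<^sup>N\<close> gives an orthogonal expansion of \<open>f\<close> whose \<open>i\<close>-th term lies
  in all of \<open>V\<^sub>N\<^sub>i, \<dots>, V\<^sub>N\<^sub>i\<^sub>+\<^sub>N\<^sub>-\<^sub>1\<close> at once; one expansion thus serves every way of weaving.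

  Plancherel's theorem is obtained from step functions: the transforms of interval indicators have
  the right inner products because \<open>\<integral> (1 - cos x) / x\<^sup>2 dx = \<pi>\<close>, and the isometries extending the transform and
  its conjugate are adjoint to each other, hence mutually inverse.
\<close>

section \<open>Projection onto closed subspaces, complex scalars over a real inner product,
  extension of isometries\<close>

section \<open>Hilbert spaces\<close>

text \<open>A minimizing sequence for the distance from \<open>f\<close> to \<open>M\<close> is
  Cauchy by the parallelogram law; its limit is a nearest point, and varying it inside
  \<open>M\<close> gives orthogonality. Only real scalars enter, so closed real spans are covered
  too.\<close>

lemma orthogonal_projection_exists:
  fixes M :: "'a::{real_inner,complete_space} set"
  assumes M: "subspace M" and "closed M"
  obtains p where "p \<in> M" "\<And>m. m \<in> M \<Longrightarrow> inner (f - p) m = 0"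
proof -
  define d where "d = infdist f M"
  have ne: "M \<noteq> {}"
    using subspace_0[OF M] by auto
  have d0: "d \<ge> 0"
    by (simp add: d_def infdist_nonneg)
  have d_le: "d \<le> norm (f - m)" if "m \<in> M" for m
    using infdist_le[OF that, of f] by (simp add: d_def dist_norm)
  have "\<exists>p\<in>M. norm (f - p) < d + 1 / Suc n" for n
  proof -
    have "(INF m\<in>M. dist f m) < d + 1 / Suc n"
      using ne by (simp add: d_def infdist_def)
    then show ?thesis
      using ne by (subst (asm) cINF_less_iff) (auto simp: dist_norm intro!: bdd_belowI[of _ 0])
  qed
  then obtain p where p: "\<And>n. p n \<in> M" "\<And>n. norm (f - p n) < d + 1 / Suc n"
    by metis
  \<comment> \<open>The midpoint of \<open>p m\<close> and \<open>p n\<close> lies in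
    \<open>M\<close>, so its distance to \<open>f\<close> is at least \<open>d\<close>; the
    parallelogram identity then bounds \<open>p m - p n\<close> by the excess of both squared
    distances over \<open>d\<^sup>2\<close>.\<close>
  have para: "(norm (p m - p n))\<^sup>2 \<le> 4 * (2 * d + 1) / Suc k" if "k \<le> m" "k \<le> n" for k m n
  proof -
    have "(1/2) *\<^sub>R (p m + p n) \<in> M"
      using M p by (intro subspace_scale subspace_add)
    then have "d \<le> norm (f - (1/2) *\<^sub>R (p m + p n))"
      by (rule d_le)
    then have "d\<^sup>2 \<le> (norm (f - (1/2) *\<^sub>R (p m + p n)))\<^sup>2"
      using d0 by (intro power_mono) auto
    also have "4 * \<dots> = 2 * (norm (f - p m))\<^sup>2 + 2 * (norm (f - p n))\<^sup>2 - (norm (p m - p n))\<^sup>2"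
      by (simp add: power2_norm_eq_inner algebra_simps inner_commute)
    finally have 1: "(norm (p m - p n))\<^sup>2 \<le> 2 * (norm (f - p m))\<^sup>2 + 2 * (norm (f - p n))\<^sup>2 - 4 * d\<^sup>2"
      by simp
    have e: "(norm (f - p i))\<^sup>2 \<le> d\<^sup>2 + (2 * d + 1) / Suc k" if "k \<le> i" for i
    proof -
      have "1 / real (Suc i) \<le> 1 / real (Suc k)"
        using that by (intro divide_left_mono) auto
      then have "norm (f - p i) \<le> d + 1 / real (Suc k)"
        using p(2)[of i] by linarith
      then have "(norm (f - p i))\<^sup>2 \<le> (d + 1 / real (Suc k))\<^sup>2"
        by (intro power_mono) auto
      also have "\<dots> = d\<^sup>2 + 2 * d / real (Suc k) + (1 / real (Suc k)) * (1 / real (Suc k))"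
        by (simp add: power2_eq_square algebra_simps)
      also have "(1 / real (Suc k)) * (1 / real (Suc k)) \<le> 1 / real (Suc k) * 1"
        by (intro mult_left_mono) auto
      finally show ?thesis
        by (simp add: add_divide_distrib)
    qed
    show ?thesis
      using 1 e[OF that(1)] e[OF that(2)] times_divide_eq_right[of 4 "2 * d + 1" "real (Suc k)"]
      by linarith
  qed
  have "Cauchy p"
  proof (rule metric_CauchyI)
    fix e :: real assume e: "0 < e"
    obtain k :: nat where k: "4 * (2 * d + 1) / e\<^sup>2 < real k"
      using reals_Archimedean2 by blast
    then have "4 * (2 * d + 1) < real (Suc k) * e\<^sup>2"
      using e by (simp add: field_simps) (smt (verit) zero_less_power)
    then have "4 * (2 * d + 1) / Suc k < e\<^sup>2"
      by (simp add: field_simps)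
    then have "norm (p m - p n) < e" if "k \<le> m" "k \<le> n" for m n
      using power2_less_imp_less[OF le_less_trans[OF para[OF that]]] e by simp
    then show "\<exists>k. \<forall>m\<ge>k. \<forall>n\<ge>k. dist (p m) (p n) < e"
      by (auto simp: dist_norm)
  qed
  then obtain q where q: "p \<longlonglongrightarrow> q"
    using Cauchy_convergent convergent_def by blast
  have qM: "q \<in> M"
    using \<open>closed M\<close> p(1) q closed_sequentially by blast
  have "(\<lambda>n. d + 1 / Suc n) \<longlonglongrightarrow> d + 0"
    by (intro tendsto_intros LIMSEQ_inverse_real_of_nat[unfolded inverse_eq_divide])
  moreover have "(\<lambda>n. norm (f - p n)) \<longlonglongrightarrow> norm (f - q)"
    by (intro tendsto_intros q)
  ultimately have dq: "norm (f - q) \<le> d"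
    using p(2) by (intro LIMSEQ_le[of "\<lambda>n. norm (f - p n)"]) (auto intro: less_imp_le)
  show thesis
  proof (rule that[OF qM])
    fix m assume m: "m \<in> M"
    show "inner (f - q) m = 0"
    proof (cases "m = 0")
      case False
      define t where "t = inner (f - q) m / inner m m"
      have mm: "inner m m > 0" using False by simp
      have "q + t *\<^sub>R m \<in> M"
        using M qM m by (intro subspace_add subspace_scale)
      then have "norm (f - q) \<le> norm (f - (q + t *\<^sub>R m))"
        using d_le dq by fastforce
      then have "(norm (f - q))\<^sup>2 \<le> (norm ((f - q) - t *\<^sub>R m))\<^sup>2"
        by (intro power_mono) (auto simp: diff_diff_add)
      also have "\<dots> = (norm (f - q))\<^sup>2 - 2 * t * inner (f - q) m + t * t * inner m m"
        unfolding power2_norm_eq_inner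
        by (simp only: inner_diff_left inner_diff_right inner_scaleR_left inner_scaleR_right)
           (simp add: algebra_simps inner_commute)
      also have "\<dots> = (norm (f - q))\<^sup>2 - (inner (f - q) m)\<^sup>2 / inner m m"
        using mm by (simp add: t_def power2_eq_square field_simps)
      finally have "(inner (f - q) m)\<^sup>2 / inner m m \<le> 0"
        by simp
      then show ?thesis
        using mm by (simp add: divide_le_0_iff)
    qed simp
  qed
qed

lemma cinner_scaleC_right: "cinner x (c *\<^sub>C y) = cnj c * cinner x y"
  by (metis cinner_commute cinner_scaleC_left complex_cnj_mult complex_cnj_cnj)

text \<open>Conjugate linearity turns the imaginary part into a real inner product against
  \<open>\<i> *\<^sub>C y\<close>, so complex statements reduce to real ones.\<close>

lemma cinner_eq_inner:
  "cinner x y = complex_of_real (inner x y) + \<i> * complex_of_real (inner x (\<i> *\<^sub>C y))"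
  by (simp add: inner_eq_Re_cinner cinner_scaleC_right complex_eq_iff)

lemma norm_scaleC: "norm (c *\<^sub>C x) = cmod c * norm x"
proof -
  have "cinner (c *\<^sub>C x) (c *\<^sub>C x) = complex_of_real ((cmod c)\<^sup>2) * cinner x x"
    by (simp add: cinner_scaleC_right cinner_scaleC_left complex_norm_square ac_simps del: of_real_power)
  then have "inner (c *\<^sub>C x) (c *\<^sub>C x) = (cmod c)\<^sup>2 * inner x x"
    by (simp add: inner_eq_Re_cinner del: of_real_power)
  then show ?thesis
    by (simp add: norm_eq_sqrt_inner real_sqrt_mult)
qed

lemma bounded_linear_scaleC: "bounded_linear (\<lambda>x::'a::complex_hilbert. c *\<^sub>C x)"
  by (rule bounded_linear_intro[where K = "cmod c"])
    (auto simp: scaleC_add_right scaleR_scaleC scaleC_scaleC mult.commute norm_scaleC)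

lemma bounded_linear_cinner_right: "bounded_linear (\<lambda>y. cinner x y)"
proof -
  have *: "bounded_linear (\<lambda>z. complex_of_real (inner x z))" for x :: 'a
    by (rule bounded_linear_compose[OF bounded_linear_of_real bounded_linear_inner_right])
  have "bounded_linear (\<lambda>y. complex_of_real (inner x y) + \<i> * complex_of_real (inner x (\<i> *\<^sub>C y)))"
    by (intro bounded_linear_add * bounded_linear_compose[OF bounded_linear_mult_right]
        bounded_linear_compose[OF * bounded_linear_scaleC])
  then show ?thesis
    by (simp add: cinner_eq_inner[symmetric])
qed

lemma csubspace_imp_subspace: "csubspace M \<Longrightarrow> subspace M"
  unfolding subspace_def
  using complex_vector.subspace_0 complex_vector.subspace_add complex_vector.subspace_scale
  by (auto simp: scaleR_scaleC)

lemma subspace_closure: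
  fixes S :: "'a::real_normed_vector set"
  assumes S: "subspace S"
  shows "subspace (closure S)"
proof (rule subspaceI)
  show "0 \<in> closure S"
    using subspace_0[OF S] closure_subset by auto
  show "x + y \<in> closure S" if xy: "x \<in> closure S" "y \<in> closure S" for x y
  proof -
    obtain s t where s: "\<And>n. s n \<in> S" "s \<longlonglongrightarrow> x" and t: "\<And>n. t n \<in> S" "t \<longlonglongrightarrow> y"
      using xy unfolding closure_sequential by blast
    have "(\<lambda>n. s n + t n) \<longlonglongrightarrow> x + y" "\<And>n. s n + t n \<in> S"
      by (rule tendsto_add[OF s(2) t(2)], rule subspace_add[OF S s(1) t(1)])
    then show ?thesis
      unfolding closure_sequential by (intro exI[of _ "\<lambda>n. s n + t n"]) auto
  qed
  show "c *\<^sub>R x \<in> closure S" if x: "x \<in> closure S" for c x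
  proof -
    obtain s where s: "\<And>n. s n \<in> S" "s \<longlonglongrightarrow> x"
      using x unfolding closure_sequential by blast
    have "(\<lambda>n. c *\<^sub>R s n) \<longlonglongrightarrow> c *\<^sub>R x" "\<And>n. c *\<^sub>R s n \<in> S"
      by (rule tendsto_scaleR[OF tendsto_const s(2)], rule subspace_scale[OF S s(1)])
    then show ?thesis
      unfolding closure_sequential by (intro exI[of _ "\<lambda>n. c *\<^sub>R s n"]) auto
  qed
qed

lemma csubspace_closure:
  fixes S :: "'a::complex_hilbert set"
  assumes "csubspace S"
  shows "csubspace (closure S)"
proof (rule complex_vector.subspaceI)
  note S = csubspace_imp_subspace[OF assms]
  have cl: "subspace (closure S)"
    using S by (rule subspace_closure)
  show "0 \<in> closure S"
    using cl by (rule subspace_0)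
  show "x + y \<in> closure S" if "x \<in> closure S" "y \<in> closure S" for x y
    using cl that by (rule subspace_add)
  show "c *\<^sub>C x \<in> closure S" if x: "x \<in> closure S" for c x
  proof -
    obtain s where s: "\<And>n. s n \<in> S" "s \<longlonglongrightarrow> x"
      using x unfolding closure_sequential by blast
    have "(\<lambda>n. c *\<^sub>C s n) \<longlonglongrightarrow> c *\<^sub>C x"
      by (rule bounded_linear.tendsto[OF bounded_linear_scaleC s(2)])
    then show ?thesis
      unfolding closure_sequential
      by (intro exI[of _ "\<lambda>n. c *\<^sub>C s n"]) (use complex_vector.subspace_scale[OF assms s(1)] in auto)
  qed
qed

lemma cinner_eq_0_csubspace:
  assumes "csubspace M" "\<And>m. m \<in> M \<Longrightarrow> inner q m = 0" "m \<in> M"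
  shows "cinner q m = 0"
  unfolding cinner_eq_inner
  using assms(2)[OF assms(3)] assms(2)[OF complex_vector.subspace_scale[OF assms(1,3), of \<i>]] by simp

text \<open>For comparing operators on generators only: the set where two continuous maps agree is
  closed.\<close>

lemma bounded_linear_eqI_dense:
  fixes f g :: "'a::real_normed_vector \<Rightarrow> 'b::real_normed_vector"
  assumes f: "bounded_linear f" and g: "bounded_linear g"
    and eq: "\<And>x. x \<in> T \<Longrightarrow> f x = g x" and T: "closure (span T) = UNIV"
  shows "f = g"
proof
  fix x
  have "f x = g x" if "x \<in> span T" for x
    by (rule linear_eq_on_span[of f g T]) (use f g eq that in \<open>auto simp: bounded_linear.linear\<close>)
  then have "closure (span T) \<subseteq> {x. f x = g x}"
    by (intro closure_minimal closed_Collect_eq)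
      (auto intro: linear_continuous_on f g)
  then show "f x = g x"
    using T by auto
qed

text \<open>The prescribed values form a relation \<open>S\<close>, so no independence of the
  generators has to be checked: preserved inner products force equal norms of the two coordinates on
  the closed span of \<open>S\<close>, which is therefore the graph of a map.\<close>

lemma isometric_extension:
  fixes S :: "('a::{real_inner,complete_space} \<times> 'b::{real_inner,complete_space}) set"
  assumes S: "\<And>p q. p \<in> S \<Longrightarrow> q \<in> S \<Longrightarrow> inner (fst p) (fst q) = inner (snd p) (snd q)"
    and dense: "closure (span (fst ` S)) = UNIV"
  obtains F where "linear F" "\<And>x. norm (F x) = norm x" "\<And>p. p \<in> S \<Longrightarrow> F (fst p) = snd p"
proof -
  \<comment> \<open>\<open>G\<close> is the graph of the extension.\<close>
  define G where "G = closure (span S)"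
  have subG: "subspace G"
    unfolding G_def by (intro subspace_closure subspace_span)
  \<comment> \<open>Bilinearity in two passes: first \<open>q\<close> is extended from
    \<open>S\<close> to its span with \<open>p\<close> in \<open>S\<close>; then the roles are
    exchanged and \<open>q = p\<close> is taken.\<close>
  have span_norm: "norm (fst p) = norm (snd p)" if p: "p \<in> span S" for p
  proof -
    have lin: "linear (\<lambda>q. inner x (fst q) - inner y (snd q))" for x :: 'a and y :: 'b
      by (rule linearI) (auto simp: inner_add_right algebra_simps)
    have 1: "inner (fst p) (fst q) - inner (snd p) (snd q) = 0" if p: "p \<in> S" and q: "q \<in> span S" for p q
      by (rule linear_eq_on_span[OF lin linear_zero _ q]) (use S p in auto)
    have "inner (fst p) (fst p) - inner (snd p) (snd p) = 0"
      by (rule linear_eq_on_span[OF lin linear_zero _ p]) (use 1 p in \<open>auto simp: inner_commute\<close>)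
    then show ?thesis by (simp add: norm_eq_sqrt_inner)
  qed
  have G_norm: "norm (fst p) = norm (snd p)" if "p \<in> G" for p
  proof -
    have "G \<subseteq> {p. norm (fst p) = norm (snd p)}"
      unfolding G_def
      by (intro closure_minimal closed_Collect_eq) (auto intro!: continuous_intros span_norm)
    then show ?thesis using that by auto
  qed
  have ex: "\<exists>y. (x, y) \<in> G" for x
  proof -
    have "x \<in> closure (fst ` span S)"
      using dense by (simp add: linear_span_image[OF linear_fst])
    then obtain s' where s': "\<And>n. s' n \<in> fst ` span S" "s' \<longlonglongrightarrow> x"
      unfolding closure_sequential by blast
    then obtain s where s: "\<And>n. s n \<in> span S" "\<And>n. s' n = fst (s n)"
      by (auto simp: image_iff) metis
    have "dist (snd (s m)) (snd (s n)) = dist (s' m) (s' n)" for m n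
      using span_norm[OF span_diff[OF s(1)[of m] s(1)[of n]]] by (simp add: dist_norm s)
    moreover have "Cauchy s'"
      using s'(2) by (rule LIMSEQ_imp_Cauchy)
    ultimately have "Cauchy (\<lambda>n. snd (s n))"
      by (simp add: Cauchy_def)
    then obtain y where "(\<lambda>n. snd (s n)) \<longlonglongrightarrow> y"
      using Cauchy_convergent convergent_def by blast
    then have "(\<lambda>n. (fst (s n), snd (s n))) \<longlonglongrightarrow> (x, y)"
      using s'(2) by (intro tendsto_Pair) (simp_all add: s(2)[abs_def])
    then show ?thesis
      unfolding G_def using s(1) closure_sequential[of "(x, y)" "span S"] by auto
  qed
  \<comment> \<open>The difference of the two pairs is \<open>(0, y - y')\<close>, whose coordinates
    have equal norm.\<close>
  have uniq: "y = y'" if "(x, y) \<in> G" "(x, y') \<in> G" for x y y'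
    using G_norm[OF subspace_diff[OF subG that]] by simp
  define F where "F x = (THE y. (x, y) \<in> G)" for x
  have F: "(x, F x) \<in> G" for x
    unfolding F_def by (rule theI') (use ex uniq in blast)
  have F_eq: "F x = y" if "(x, y) \<in> G" for x y
    using uniq[OF F that] .
  show thesis
  proof
    show "linear F"
    proof (rule linearI)
      show "F (x + y) = F x + F y" for x y
        using subspace_add[OF subG F[of x] F[of y]] by (intro F_eq) simp
      show "F (c *\<^sub>R x) = c *\<^sub>R F x" for c x
        using subspace_scale[OF subG F[of x], of c] by (intro F_eq) simp
    qed
    show "norm (F x) = norm x" for x
      using G_norm[OF F[of x]] by simp
    show "F (fst p) = snd p" if "p \<in> S" for p
      using that closure_subset[of "span S"] by (intro F_eq) (auto simp: G_def span_base)
  qed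
qed

text \<open>The real extension is applied to all pairs
  \<open>(c *\<^sub>C e i, c *\<^sub>C g i)\<close>; with complex multiples among the generators it
  commutes with complex scalars.\<close>

lemma complex_isometric_extension:
  fixes e :: "'i \<Rightarrow> 'a::complex_hilbert" and g :: "'i \<Rightarrow> 'b::complex_hilbert"
  assumes eg: "\<And>i j. cinner (g i) (g j) = cinner (e i) (e j)"
    and dense: "closure (span (range (\<lambda>(c, i). c *\<^sub>C e i))) = UNIV"
  obtains F where "Vector_Spaces.linear scaleC scaleC F" "\<And>x y. cinner (F x) (F y) = cinner x y"
    "\<And>i. F (e i) = g i"
proof -
  let ?S = "range (\<lambda>(c, i). (c *\<^sub>C e i, c *\<^sub>C g i))"
  obtain F where F: "linear F" "\<And>x. norm (F x) = norm x" "\<And>p. p \<in> ?S \<Longrightarrow> F (fst p) = snd p"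
  proof (rule isometric_extension[of ?S])
    show "inner (fst p) (fst q) = inner (snd p) (snd q)" if "p \<in> ?S" "q \<in> ?S" for p q
      using that by (auto simp: inner_eq_Re_cinner cinner_scaleC_right cinner_scaleC_left eg)
    have "fst ` ?S = range (\<lambda>(c, i). c *\<^sub>C e i)"
      by (force simp: image_iff)
    then show "closure (span (fst ` ?S)) = UNIV"
      using dense by simp
  qed blast
  have Fe: "F (c *\<^sub>C e i) = c *\<^sub>C g i" for c i
    using F(3)[OF rangeI[of _ "(c, i)"]] by simp
  have blF: "bounded_linear F"
    using F(1,2) by (intro bounded_linear_intro[where K = 1]) (auto simp: linear_add linear_cmul)
  have Fc: "F (c *\<^sub>C x) = c *\<^sub>C F x" for c x
  proof -
    have "(\<lambda>x. F (c *\<^sub>C x)) = (\<lambda>x. c *\<^sub>C F x)"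
      by (rule bounded_linear_eqI_dense[OF bounded_linear_compose[OF blF bounded_linear_scaleC]
          bounded_linear_compose[OF bounded_linear_scaleC blF] _ dense])
        (auto simp: scaleC_scaleC Fe)
    then show ?thesis by metis
  qed
  \<comment> \<open>Real polarization: the norms of \<open>x\<close>, \<open>y\<close> and
    \<open>x + y\<close> determine the inner product.\<close>
  have inn: "inner (F x) (F y) = inner x y" for x y
  proof -
    have "(norm (F (x + y)))\<^sup>2 = (norm (x + y))\<^sup>2" "(norm (F x))\<^sup>2 = (norm x)\<^sup>2" "(norm (F y))\<^sup>2 = (norm y)\<^sup>2"
      by (simp_all add: F(2))
    then show ?thesis
      unfolding power2_norm_eq_inner linear_add[OF F(1)]
      by (simp add: inner_add_left inner_add_right inner_commute)
  qed
  show thesis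
  proof
    show "Vector_Spaces.linear scaleC scaleC F"
      by unfold_locales (auto simp: linear_add[OF F(1)] Fc)
    show "cinner (F x) (F y) = cinner x y" for x y
      unfolding cinner_eq_inner by (simp add: inn flip: Fc)
    show "F (e i) = g i" for i
      using Fe[of 1] by (simp add: scaleC_one)
  qed
qed

section \<open>Functions determined by their interval integrals, and density of interval
  indicators\<close>

section \<open>Step functions\<close>

text \<open>The Borel sets over which \<open>h\<close> integrates to 0 include the compact intervals
  and are closed under complements and countable disjoint unions, so they are all Borel sets.
  Testing where \<open>Re h\<close>, \<open>- Re h\<close>, \<open>Im h\<close> or
  \<open>- Im h\<close> is positive shows that \<open>h\<close> vanishes.\<close>

lemma AE_eq_0_if_interval_integrals_0_integrable:
  fixes h :: "real \<Rightarrow> complex"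
  assumes h: "integrable lborel h"
    and 0: "\<And>a b. a \<le> b \<Longrightarrow> (\<integral>x. indicator {a..b} x * h x \<partial>lborel) = 0"
  shows "AE x in lborel. h x = 0"
proof -
  have [measurable]: "h \<in> borel_measurable borel"
    using borel_measurable_integrable[OF h] by simp
  have int: "integrable lborel (\<lambda>x. indicator A x * h x)" if "A \<in> sets borel" for A
  proof -
    have "indicator A x *\<^sub>R h x = indicator A x * h x" for x
      by (simp add: indicator_def)
    then show ?thesis
      using integrable_mult_indicator[OF _ h, of A] that by simp
  qed
  \<comment> \<open>The integral over the whole line, from which the complement case
    subtracts.\<close>
  have tot: "(\<integral>x. h x \<partial>lborel) = 0"
  proof -
    have "(\<lambda>n. \<integral>x. indicator {- real n..real n} x * h x \<partial>lborel) \<longlonglongrightarrow> (\<integral>x. h x \<partial>lborel)"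
    proof (rule integral_dominated_convergence[where w = "\<lambda>x. cmod (h x)"])
      show "AE x in lborel. (\<lambda>n. indicator {- real n..real n} x * h x) \<longlonglongrightarrow> h x"
      proof (intro always_eventually allI)
        fix x
        obtain n :: nat where n: "\<bar>x\<bar> \<le> real n"
          using real_arch_simple by blast
        have "\<forall>\<^sub>F m in sequentially. h x = indicator {- real m..real m} x * h x"
          using eventually_ge_at_top[of n] by eventually_elim (use n in \<open>auto simp: indicator_def\<close>)
        then show "(\<lambda>n. indicator {- real n..real n} x * h x) \<longlonglongrightarrow> h x"
          by (rule Lim_transform_eventually[OF tendsto_const])
      qed
      show "\<And>n. AE x in lborel. cmod (indicator {- real n..real n} x * h x) \<le> cmod (h x)"
        by (auto simp: indicator_def)
    qed (use h in auto)
    moreover have "(\<integral>x. indicator {- real n..real n} x * h x \<partial>lborel) = 0" for n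
      by (rule 0) auto
    ultimately show ?thesis
      using LIMSEQ_unique[OF _ tendsto_const] by simp
  qed
  have all: "(\<integral>x. indicator A x * h x \<partial>lborel) = 0" if "A \<in> sets borel" for A
    using that
  proof (induction rule: borel_set_induct)
    case (compl A)
    then have A: "A \<in> sets borel" by simp
    have "(\<integral>x. indicator (- A) x * h x \<partial>lborel) = (\<integral>x. h x - indicator A x * h x \<partial>lborel)"
      by (intro Bochner_Integration.integral_cong) (auto simp: indicator_def)
    then show ?case
      using tot compl h int[OF A] by simp
  next
    case (union f)
    have "(\<lambda>n. \<Sum>i<n. indicator (f i) x * h x) \<longlonglongrightarrow> indicator (\<Union>i. f i) x * h x" for x
    proof (cases "\<exists>i. x \<in> f i")
      case True
      then obtain i where i: "x \<in> f i" by blast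
      have *: "indicator (f j) x = (if j = i then 1 else (0::complex))" for j
        using i union(1) by (auto simp: indicator_def disjoint_family_on_def)
      have **: "indicator (\<Union>i. f i) x = (1::complex)"
        using i by (auto simp: indicator_def)
      have "\<forall>\<^sub>F n in sequentially. indicator (\<Union>i. f i) x * h x = (\<Sum>i<n. indicator (f i) x * h x)"
        using eventually_gt_at_top[of i]
        by eventually_elim (simp add: * ** if_distrib if_distribR sum.delta cong: if_cong)
      then show ?thesis
        by (rule Lim_transform_eventually[OF tendsto_const])
    qed (simp add: indicator_def)
    note lim = this
    have "(\<lambda>n. \<integral>x. (\<Sum>i<n. indicator (f i) x * h x) \<partial>lborel) \<longlonglongrightarrow> (\<integral>x. indicator (\<Union>i. f i) x * h x \<partial>lborel)"
    proof (rule integral_dominated_convergence[where w = "\<lambda>x. cmod (h x)"])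
      show "AE x in lborel. cmod (\<Sum>i<n. indicator (f i) x * h x) \<le> cmod (h x)" for n
      proof (intro always_eventually allI)
        fix x
        have "(\<Sum>i<n. indicator (f i) x) = (indicator (\<Union>i<n. f i) x :: complex)"
          using union(1) by (intro indicator_UN_disjoint[symmetric])
            (auto simp: disjoint_family_on_def)
        then show "cmod (\<Sum>i<n. indicator (f i) x * h x) \<le> cmod (h x)"
          by (simp add: sum_distrib_right[symmetric] indicator_def)
      qed
    qed (use h lim union(2) in auto)
    moreover have "(\<integral>x. (\<Sum>i<n. indicator (f i) x * h x) \<partial>lborel) = 0" for n
      using union int by (subst Bochner_Integration.integral_sum) auto
    ultimately show ?case
      using LIMSEQ_unique[OF _ tendsto_const] by simp
  qed (use 0 in auto)
  have pos0: "AE x in lborel. \<not> g (h x) > 0" if g: "bounded_linear g" for g :: "complex \<Rightarrow> real"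
  proof -
    have [measurable]: "g \<in> borel_measurable borel"
      using linear_continuous_on[OF g] by (intro borel_measurable_continuous_onI)
    define A where "A = {x. g (h x) > 0}"
    have A[measurable]: "A \<in> sets borel"
      unfolding A_def by measurable
    have "integrable lborel (\<lambda>x. g (indicator A x * h x))"
      by (rule integrable_bounded_linear[OF g int[OF A]])
    moreover have "(\<integral>x. g (indicator A x * h x) \<partial>lborel) = 0"
      using integral_bounded_linear[OF g int[OF A]] all[OF A] by (simp add: linear_0 bounded_linear.linear[OF g])
    ultimately have "AE x in lborel. g (indicator A x * h x) = 0"
      by (subst (asm) integral_nonneg_eq_0_iff_AE)
        (auto simp: indicator_def A_def linear_0 bounded_linear.linear[OF g])
    then show ?thesis
      by eventually_elim (auto simp: A_def indicator_def split: if_splits)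
  qed
  have "AE x in lborel. \<not> Re (h x) > 0" "AE x in lborel. \<not> - Re (h x) > 0"
    "AE x in lborel. \<not> Im (h x) > 0" "AE x in lborel. \<not> - Im (h x) > 0"
    by (intro pos0 bounded_linear_minus bounded_linear_Re bounded_linear_Im)+
  then show ?thesis
    by eventually_elim (auto simp: complex_eq_iff)
qed

text \<open>Local version for square-integrable functions, which need not be integrable on the whole
  line: \<open>h\<close> is cut to \<open>{- real n..real n}\<close>, and cutting an interval leaves
  an interval or the empty set.\<close>

lemma AE_eq_0_if_interval_integrals_0:
  fixes h :: "real \<Rightarrow> complex"
  assumes h: "\<And>a b. integrable lborel (\<lambda>x. indicator {a..b} x * h x)"
    and 0: "\<And>a b. a \<le> b \<Longrightarrow> (\<integral>x. indicator {a..b} x * h x \<partial>lborel) = 0"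
  shows "AE x in lborel. h x = 0"
proof -
  have "AE x in lborel. indicator {- real n..real n} x * h x = 0" for n
  proof (rule AE_eq_0_if_interval_integrals_0_integrable[OF h])
    fix a b :: real
    have *: "indicator {a..b} x * (indicator {- real n..real n} x * h x)
        = indicator {max a (- real n)..min b (real n)} x * h x" for x
      by (auto simp: indicator_def)
    show "(\<integral>x. indicator {a..b} x * (indicator {- real n..real n} x * h x) \<partial>lborel) = 0"
      unfolding * using 0[of "max a (- real n)" "min b (real n)"]
      by (cases "max a (- real n) \<le> min b (real n)") auto
  qed
  then have "AE x in lborel. \<forall>n. indicator {- real n..real n} x * h x = 0"
    by (subst AE_all_countable) blast
  then show ?thesis
  proof eventually_elim
    fix x assume *: "\<forall>n. indicator {- real n..real n} x * h x = 0"
    obtain n :: nat where "\<bar>x\<bar> \<le> real n"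
      using real_arch_simple by blast
    then show "h x = 0"
      using *[rule_format, of n] by (auto simp: indicator_def)
  qed
qed

lemma cinner_abs_l2:
  assumes "square_integrable f" "square_integrable g"
  shows "cinner (abs_l2 f) (abs_l2 g) = (\<integral>x. f x * cnj (g x) \<partial>lborel)"
  using assms by (intro cinner_l2.abs_eq) (auto simp: l2_rel_def)

lemma cinner_rep_l2: "cinner f g = (\<integral>x. rep_l2 f x * cnj (rep_l2 g x) \<partial>lborel)"
  using cinner_abs_l2[OF square_integrable_rep square_integrable_rep, of f g] by (simp add: abs_rep_l2)

lemma scaleC_abs_l2:
  assumes "square_integrable f"
  shows "c *\<^sub>C abs_l2 f = abs_l2 (\<lambda>x. c * f x)"
  using assms by (intro scaleC_l2.abs_eq) (auto simp: l2_rel_def)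

lemma plus_abs_l2:
  assumes "square_integrable f" "square_integrable g"
  shows "abs_l2 f + abs_l2 g = abs_l2 (\<lambda>x. f x + g x)"
  using assms by (intro plus_l2.abs_eq) (auto simp: l2_rel_def)

lemma eq_rep_l2_iff: "f = g \<longleftrightarrow> (AE x in lborel. rep_l2 f x = rep_l2 g x)"
  using abs_l2_eq_iff[OF square_integrable_rep square_integrable_rep, of f g] by (simp add: abs_rep_l2)

lemma square_integrable_indicator:
  "square_integrable (indicator {a..b})" "integrable lborel (indicator {a..b} :: real \<Rightarrow> complex)"
proof -
  have "(cmod (indicator {a..b} x))\<^sup>2 = indicator {a..b} x" for x :: real
    by (simp add: indicator_def)
  then show "square_integrable (indicator {a..b})"
    by (simp add: square_integrable_def emeasure_lborel_Icc_eq)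
  show "integrable lborel (indicator {a..b} :: real \<Rightarrow> complex)"
  proof -
    have "indicator {a..b} = (\<lambda>x. complex_of_real (indicator {a..b} x))"
      by (auto simp: indicator_def)
    moreover have "integrable lborel (\<lambda>x. complex_of_real (indicator {a..b} x))"
      by (intro integrable_of_real) (simp add: emeasure_lborel_Icc_eq)
    ultimately show ?thesis by simp
  qed
qed

definition interval_l2 :: "real \<times> real \<Rightarrow> l2" where
  "interval_l2 = (\<lambda>(a, b). abs_l2 (indicator {a..b}))"

lemma cinner_interval_l2_right:
  assumes "square_integrable f"
  shows "cinner (abs_l2 f) (interval_l2 (a, b)) = (\<integral>x. indicator {a..b} x * f x \<partial>lborel)"
    "integrable lborel (\<lambda>x. indicator {a..b} x * f x)"
proof -
  have *: "f x * cnj (indicator {a..b} x) = indicator {a..b} x * f x" for x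
    by (simp add: indicator_def)
  show "cinner (abs_l2 f) (interval_l2 (a, b)) = (\<integral>x. indicator {a..b} x * f x \<partial>lborel)"
    by (simp add: interval_l2_def cinner_abs_l2[OF assms square_integrable_indicator(1)] *)
  show "integrable lborel (\<lambda>x. indicator {a..b} x * f x)"
    using integrable_mult_cnj[OF assms square_integrable_indicator(1), of a b] by (simp add: *)
qed

text \<open>The residue \<open>q\<close> of a projection is orthogonal to every interval indicator,
  so its interval integrals vanish. A real span of complex multiples is the form that the extension
  and comparison of operators ask for.\<close>

lemma dense_interval_l2: "closure (span (range (\<lambda>(c, i). c *\<^sub>C interval_l2 i))) = UNIV"
proof -
  let ?M = "closure (span (range (\<lambda>(c, i). c *\<^sub>C interval_l2 i)))"
  have "f \<in> ?M" for f
  proof -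
    obtain p where p: "p \<in> ?M" "\<And>m. m \<in> ?M \<Longrightarrow> inner (f - p) m = 0"
      using orthogonal_projection_exists[of ?M f]
      by (metis closed_closure subspace_closure subspace_span)
    define q where "q = f - p"
    have q: "inner q (c *\<^sub>C interval_l2 i) = 0" for c i
      unfolding q_def
      by (intro p(2) closure_subset[THEN subsetD] span_base) auto
    have "cinner q (interval_l2 i) = 0" for i
      unfolding cinner_eq_inner using q[of 1 i] q[of \<i> i] by (simp add: scaleC_one)
    then have "(\<integral>x. indicator {a..b} x * rep_l2 q x \<partial>lborel) = 0" for a b
      using cinner_interval_l2_right(1)[OF square_integrable_rep, of q a b] by (simp add: abs_rep_l2)
    then have "AE x in lborel. rep_l2 q x = 0"
      by (intro AE_eq_0_if_interval_integrals_0 cinner_interval_l2_right(2) square_integrable_rep)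
    then have "abs_l2 (rep_l2 q) = abs_l2 (\<lambda>_. 0)"
      by (subst abs_l2_eq_iff) (auto simp: square_integrable_rep square_integrable_0)
    then have "q = 0"
      by (simp add: abs_rep_l2 zero_l2_def)
    then show ?thesis
      using p(1) by (simp add: q_def)
  qed
  then show ?thesis by blast
qed

section \<open>The integral of \<open>(1 - cos x) / x\<^sup>2\<close>, transforms of interval
  indicators, existence and uniqueness of the unitary extension\<close>

section \<open>Plancherel's theorem\<close>

text \<open>On the positive half-line \<open>Si x - (1 - cos x) / x\<close> is an antiderivative; it
  tends to 0 at 0 and, by the Dirichlet integral, to \<open>pi / 2\<close> at infinity. The negative
  half-line follows by reflection.\<close>

lemma has_bochner_integral_one_minus_cos:
  "has_bochner_integral lborel (\<lambda>x::real. (1 - cos x) / x\<^sup>2) pi"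
proof -
  let ?f = "\<lambda>x::real. (1 - cos x) / x\<^sup>2"
  let ?G = "\<lambda>x::real. Si x - (1 - cos x) / x"
  have G0: "(?G \<longlongrightarrow> 0) (at_right 0)"
  proof -
    have "((\<lambda>h. (cos (0 + h) - cos 0) / h) \<longlongrightarrow> - sin 0) (at (0::real))"
      using DERIV_cos[of "0::real"] unfolding DERIV_def .
    then have "((\<lambda>h. - ((cos h - 1) / h)) \<longlongrightarrow> - 0) (at_right (0::real))"
      by (intro tendsto_minus) (auto intro: filterlim_mono at_le)
    then have "((\<lambda>h. (1 - cos h) / h) \<longlongrightarrow> 0) (at_right (0::real))"
      by (simp add: minus_divide_left)
    moreover have "(Si \<longlongrightarrow> Si 0) (at_right 0)"
      using isCont_Si[of 0] by (auto simp: isCont_def intro: filterlim_mono at_le)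
    moreover have "Si 0 = 0"
      by (simp add: Si_alt_def zero_ereal_def)
    ultimately show ?thesis
      using tendsto_diff[of Si 0 "at_right 0" "\<lambda>h. (1 - cos h) / h" 0] by simp
  qed
  have G1: "(?G \<longlongrightarrow> pi / 2) at_top"
  proof -
    have "((\<lambda>x::real. (1 - cos x) / x) \<longlongrightarrow> 0) at_top"
    proof (rule tendsto_sandwich[of "\<lambda>_. 0" _ _ "\<lambda>x. 2 / x"])
      show "\<forall>\<^sub>F x in at_top. 0 \<le> (1 - cos x) / (x::real)"
        using eventually_gt_at_top[of 0] by eventually_elim simp
      show "\<forall>\<^sub>F x in at_top. (1 - cos x) / (x::real) \<le> 2 / x"
        using eventually_gt_at_top[of 0]
      proof eventually_elim
        case (elim x)
        then show ?case using cos_ge_minus_one[of x] by (intro divide_right_mono) auto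
      qed
      show "((\<lambda>x::real. 2 / x) \<longlongrightarrow> 0) at_top"
        by (intro real_tendsto_divide_at_top[OF tendsto_const] filterlim_ident)
    qed auto
    then show ?thesis
      using tendsto_diff[OF Si_at_top] by fastforce
  qed
  have D: "(?G has_real_derivative ?f x) (at x)" if "x > 0" for x
    using that
    by (auto intro!: derivative_eq_intros DERIV_Si simp: field_simps power2_eq_square)
  have FTC: "set_integrable lborel (einterval 0 \<infinity>) ?f" "(LBINT x=0..\<infinity>. ?f x) = pi / 2 - 0"
    by (rule interval_integral_FTC_nonneg[where F = ?G];
        use G0 G1 D in \<open>auto simp: ereal_tendsto_simps zero_ereal_def intro!: continuous_intros\<close>)+
  have einter: "einterval 0 \<infinity> = {0::real<..}"
    by (auto simp: einterval_def)
  have pos: "has_bochner_integral lborel (\<lambda>x. indicator {0<..} x * ?f x) (pi / 2)"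
    using FTC unfolding einter interval_lebesgue_integral_0_infty
    by (simp add: has_bochner_integral_iff set_integrable_def set_lebesgue_integral_def)
  have neg: "has_bochner_integral lborel (\<lambda>x. indicator {..<0} x * ?f x) (pi / 2)"
    using pos lborel_has_bochner_integral_real_affine_iff[of "-1" "\<lambda>x. indicator {0<..} x * ?f x" "pi / 2" 0]
    by (simp add: indicator_def)
  \<comment> \<open>The point 0 agrees as well, since \<open>0 / 0 = 0\<close> makes
    \<open>?f 0\<close> zero.\<close>
  have "indicator {0<..} x * ?f x + indicator {..<0} x * ?f x = ?f x" for x
    by (cases x "0::real" rule: linorder_cases) (auto simp: indicator_def)
  then show ?thesis
    using has_bochner_integral_add[OF pos neg] by simp
qed

text \<open>The substitution has Jacobian \<open>1 / \<bar>2 * pi * t\<bar>\<close>, and the factor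
  \<open>t\<^sup>2\<close> restores the denominator. For \<open>t = 0\<close> both sides
  vanish.\<close>

lemma has_bochner_integral_one_minus_cos_scaled:
  "has_bochner_integral lborel (\<lambda>x::real. (1 - cos (2 * pi * x * t)) / (2 * pi * x)\<^sup>2) (\<bar>t\<bar> / 2)"
proof (cases "t = 0")
  case False
  have "has_bochner_integral lborel
      (\<lambda>x. t\<^sup>2 * ((1 - cos (0 + (2 * pi * t) * x)) / (0 + (2 * pi * t) * x)\<^sup>2)) (t\<^sup>2 * (pi /\<^sub>R \<bar>2 * pi * t\<bar>))"
    using False has_bochner_integral_one_minus_cos
    by (intro has_bochner_integral_mult_right)
      (subst lborel_has_bochner_integral_real_affine_iff[symmetric], auto)
  moreover have "t\<^sup>2 * (pi /\<^sub>R \<bar>2 * pi * t\<bar>) = \<bar>t\<bar> / 2"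
    using False by (simp add: abs_mult field_simps power2_eq_square)
  moreover have "t\<^sup>2 * ((1 - cos (0 + (2 * pi * t) * x)) / (0 + (2 * pi * t) * x)\<^sup>2)
      = (1 - cos (2 * pi * x * t)) / (2 * pi * x)\<^sup>2" for x
    using False by (simp add: power_mult_distrib ac_simps)
  ultimately show ?thesis by (simp only:)
qed (simp add: has_bochner_integral_iff)

lemma cis_eq_fourier_kernel: "exp (- 2 * complex_of_real pi * \<i> * complex_of_real y) = cis (- (2 * pi * y))"
  by (simp add: cis_conv_exp ac_simps)

lemma fourier_integral_cis: "fourier_integral f \<gamma> = (\<integral>x. f x * cis (- (2 * pi * (x * \<gamma>))) \<partial>lborel)"
  unfolding fourier_integral_def cis_eq_fourier_kernel ..

lemma borel_measurable_cis [measurable]: "cis \<in> borel_measurable borel"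
  by (intro borel_measurable_continuous_onI continuous_intros)

lemma borel_measurable_cnj [measurable]: "cnj \<in> borel_measurable borel"
  by (intro borel_measurable_continuous_onI continuous_intros)

lemma borel_measurable_fourier_integral [measurable]:
  assumes [measurable]: "f \<in> borel_measurable borel"
  shows "fourier_integral f \<in> borel_measurable borel"
  unfolding fourier_integral_cis[abs_def] by measurable

text \<open>Fubini: the kernel is symmetric in the two variables and of modulus one, so the double
  integrand is integrable.\<close>

lemma fourier_integral_duality:
  assumes f: "integrable lborel f" and g: "integrable lborel g"
  shows "(\<integral>\<gamma>. fourier_integral f \<gamma> * g \<gamma> \<partial>lborel) = (\<integral>x. f x * fourier_integral g x \<partial>lborel)"
proof -
  have [measurable]: "f \<in> borel_measurable borel" "g \<in> borel_measurable borel"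
    using f g by (auto dest: borel_measurable_integrable)
  let ?h = "\<lambda>x y. f x * g y * cis (- (2 * pi * (x * y)))"
  have "integrable (lborel \<Otimes>\<^sub>M lborel) (\<lambda>(x, y). ?h x y)"
  proof (rule lborel_pair.Fubini_integrable)
    show "integrable lborel (\<lambda>x. \<integral>y. norm (case (x, y) of (x, y) \<Rightarrow> ?h x y) \<partial>lborel)"
      using f by (simp add: norm_mult)
    show "AE x in lborel. integrable lborel (\<lambda>y. case (x, y) of (x, y) \<Rightarrow> ?h x y)"
    proof (intro always_eventually allI)
      fix x
      have "integrable lborel (\<lambda>y. ?h x y)"
        by (rule Bochner_Integration.integrable_bound[where f = "\<lambda>y. cmod (f x) * g y"])
          (use g in \<open>auto simp: norm_mult\<close>)
      then show "integrable lborel (\<lambda>y. case (x, y) of (x, y) \<Rightarrow> ?h x y)"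
        by simp
    qed
  qed measurable
  from lborel_pair.Fubini_integral[OF this]
  have "(\<integral>y. (\<integral>x. ?h x y \<partial>lborel) \<partial>lborel) = (\<integral>x. (\<integral>y. ?h x y \<partial>lborel) \<partial>lborel)"
    by simp
  moreover have "(\<integral>x. ?h x y \<partial>lborel) = fourier_integral f y * g y" for y
    unfolding fourier_integral_cis
    by (subst Bochner_Integration.integral_mult_left_zero[symmetric]) (simp add: ac_simps)
  moreover have "(\<integral>y. ?h x y \<partial>lborel) = f x * fourier_integral g x" for x
    unfolding fourier_integral_cis
    by (subst Bochner_Integration.integral_mult_right_zero[symmetric]) (simp add: ac_simps)
  ultimately show ?thesis by simp
qed

lemma fourier_integral_indicator:
  assumes "a \<le> b" "\<gamma> \<noteq> 0"
  shows "fourier_integral (indicator {a..b}) \<gamma>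
    = \<i> * (cis (- (2 * pi * (b * \<gamma>))) - cis (- (2 * pi * (a * \<gamma>)))) / complex_of_real (2 * pi * \<gamma>)"
proof -
  define c where "c = - 2 * complex_of_real pi * \<i> * complex_of_real \<gamma>"
  have c: "c \<noteq> 0" using assms by (simp add: c_def)
  have cis: "cis (- (2 * pi * (x * \<gamma>))) = exp (c * complex_of_real x)" for x
    by (simp add: cis_conv_exp c_def ac_simps)
  have "(\<integral>x. indicator {a..b} x *\<^sub>R exp (c * complex_of_real x) \<partial>lborel)
      = exp (c * complex_of_real b) / c - exp (c * complex_of_real a) / c"
  proof (rule integral_FTC_Icc[OF assms(1)])
    show "((\<lambda>x. exp (c * complex_of_real x) / c) has_vector_derivative exp (c * complex_of_real x))
        (at x within {a..b})" for x
      by (rule has_vector_derivative_real_field[where f = "\<lambda>z. exp (c * z) / c"])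
        (use c in \<open>auto intro!: derivative_eq_intros\<close>)
  qed (auto intro!: continuous_intros)
  moreover have "indicator {a..b} x *\<^sub>R exp (c * complex_of_real x)
      = indicator {a..b} x * cis (- (2 * pi * (x * \<gamma>)))" for x
    by (simp add: indicator_def cis)
  ultimately have "fourier_integral (indicator {a..b}) \<gamma>
      = (cis (- (2 * pi * (b * \<gamma>))) - cis (- (2 * pi * (a * \<gamma>)))) / c"
    by (simp add: fourier_integral_cis cis diff_divide_distrib)
  moreover have "z / c = \<i> * z / complex_of_real (2 * pi * \<gamma>)" for z
    using assms(2) by (simp add: c_def field_simps)
  ultimately show ?thesis by metis
qed

lemma cnj_fourier_integral_indicator:
  "cnj (fourier_integral (indicator {a..b}) \<gamma>) = fourier_integral (indicator {a..b}) (- \<gamma>)"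
proof -
  have "cnj (indicator {a..b} x * cis y) = indicator {a..b} x * cis (- y)" for x y
    by (simp add: indicator_def cis_cnj)
  then show ?thesis
    unfolding fourier_integral_cis Bochner_Integration.integral_cnj[symmetric] by simp
qed

text \<open>The product of the numerators has four exponentials with coefficients adding up to 0, so
  each \<open>cos\<close> may be replaced by \<open>cos - 1\<close>; the four resulting quotients
  are separately integrable.\<close>

lemma Re_fourier_integral_indicator_mult:
  assumes "a \<le> b" "c \<le> d" "\<gamma> \<noteq> 0"
  defines "\<phi> \<equiv> \<lambda>t. (1 - cos (2 * pi * \<gamma> * t)) / (2 * pi * \<gamma>)\<^sup>2"
  shows "Re (fourier_integral (indicator {a..b}) \<gamma> * cnj (fourier_integral (indicator {c..d}) \<gamma>))
    = \<phi> (c - b) + \<phi> (d - a) - \<phi> (d - b) - \<phi> (c - a)"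
proof -
  define w where "w = 2 * pi * \<gamma>"
  have w: "w \<noteq> 0" using assms by (simp add: w_def)
  have cis: "cis (- (2 * pi * (x * \<gamma>))) = cis (- (w * x))" for x
    by (simp add: w_def ac_simps)
  have quot: "(\<i> * x / complex_of_real w) * cnj (\<i> * y / complex_of_real w) = x * cnj y / complex_of_real (w\<^sup>2)" for x y
  proof -
    have "\<i> * x * (\<i> * z) = - (x * z)" for z
      by (simp add: complex_eq_iff)
    then show ?thesis by (simp add: power2_eq_square)
  qed
  have "fourier_integral (indicator {a..b}) \<gamma> * cnj (fourier_integral (indicator {c..d}) \<gamma>)
      = (cis (- (w * b)) - cis (- (w * a))) * (cis (w * d) - cis (w * c)) / complex_of_real (w\<^sup>2)"
    unfolding fourier_integral_indicator[OF assms(1,3)] fourier_integral_indicator[OF assms(2,3)]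
      w_def[symmetric] cis quot by (simp add: cis_cnj)
  also have "(cis (- (w * b)) - cis (- (w * a))) * (cis (w * d) - cis (w * c))
      = cis (w * (d - b)) - cis (w * (c - b)) - cis (w * (d - a)) + cis (w * (c - a))"
    by (simp add: algebra_simps cis_mult)
  finally show ?thesis
    by (simp only:) (simp add: \<phi>_def w_def[symmetric] diff_divide_distrib add_divide_distrib
        del: of_real_power)
qed

text \<open>The four integrals, each of the form \<open>\<bar>t\<bar> / 2\<close>, combine to the
  length of the overlap of the two intervals, which is the inner product of their
  indicators.\<close>

lemma fourier_integral_indicator_isometry:
  shows "square_integrable (fourier_integral (indicator {a..b}))" (is ?sq)
    and "(\<integral>\<gamma>. fourier_integral (indicator {a..b}) \<gamma> * cnj (fourier_integral (indicator {c..d}) \<gamma>) \<partial>lborel)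
      = cinner (interval_l2 (a, b)) (interval_l2 (c, d))" (is ?eq)
proof -
  let ?F = "\<lambda>a b. fourier_integral (indicator {a..b})"
  let ?\<phi> = "\<lambda>t \<gamma>. (1 - cos (2 * pi * \<gamma> * t)) / (2 * pi * \<gamma>)\<^sup>2"
  note phi = has_bochner_integral_one_minus_cos_scaled
  have AE0: "AE \<gamma> in lborel. \<gamma> \<noteq> (0::real)"
    by (rule AE_lborel_singleton)
  have [measurable]: "?F a b \<in> borel_measurable borel" for a b
    by measurable
  have F0: "?F a b = (\<lambda>_. 0)" if "b < a" for a b
    using that by (auto simp: fourier_integral_def)
  have sq: "square_integrable (?F a b)" for a b
  proof (cases "a \<le> b")
    case True
    have "integrable lborel (\<lambda>\<gamma>. ?\<phi> (a - b) \<gamma> + ?\<phi> (b - a) \<gamma> - ?\<phi> (b - b) \<gamma> - ?\<phi> (a - a) \<gamma>)"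
      by (intro Bochner_Integration.integrable_add Bochner_Integration.integrable_diff integrable.intros[OF phi])
    then have "integrable lborel (\<lambda>\<gamma>. (cmod (?F a b \<gamma>))\<^sup>2)"
    proof (rule integrable_cong_AE_imp)
      show "AE \<gamma> in lborel. ?\<phi> (a - b) \<gamma> + ?\<phi> (b - a) \<gamma> - ?\<phi> (b - b) \<gamma> - ?\<phi> (a - a) \<gamma> = (cmod (?F a b \<gamma>))\<^sup>2"
        using AE0
      proof eventually_elim
        case (elim \<gamma>)
        show ?case
          using Re_fourier_integral_indicator_mult[OF True True elim]
          by (simp add: complex_norm_square[symmetric] del: of_real_power)
      qed
    qed measurable
    then show ?thesis by (simp add: square_integrable_def)
  next
    case False
    then show ?thesis using F0 square_integrable_0 by (metis not_le)
  qed
  then show ?sq .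
  have *: "indicator {a..b} x * cnj (indicator {c..d} x) = complex_of_real (indicator {max a c..min b d} x)" for x
    by (auto simp: indicator_def)
  have rhs: "cinner (interval_l2 (a, b)) (interval_l2 (c, d)) = of_real (max 0 (min b d - max a c))"
  proof -
    have m: "(\<integral>x. indicator {p..q} x \<partial>lborel) = max 0 (q - p)" for p q :: real
      by (cases "p \<le> q") auto
    show ?thesis
      by (simp only: interval_l2_def prod.case cinner_abs_l2 square_integrable_indicator *
          integral_complex_of_real m)
  qed
  show ?eq
  proof (cases "a \<le> b \<and> c \<le> d")
    case True
    let ?P = "\<lambda>\<gamma>. ?F a b \<gamma> * cnj (?F c d \<gamma>)"
    have intP: "integrable lborel ?P"
      by (intro integrable_mult_cnj sq)
    \<comment> \<open>Reflecting \<open>\<gamma>\<close> conjugates the integrand, so the integral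
      is real.\<close>
    have "cnj (\<integral>\<gamma>. ?P \<gamma> \<partial>lborel) = (\<integral>\<gamma>. ?P (0 + (-1) * \<gamma>) \<partial>lborel)"
      unfolding Bochner_Integration.integral_cnj[symmetric] by (simp add: cnj_fourier_integral_indicator)
    also have "\<dots> = (\<integral>\<gamma>. ?P \<gamma> \<partial>lborel)"
      by (subst (2) lborel_integral_real_affine[where c = "-1" and t = 0]) auto
    finally have Im: "Im (\<integral>\<gamma>. ?P \<gamma> \<partial>lborel) = 0"
      by (simp add: complex_eq_iff)
    have hb: "has_bochner_integral lborel (\<lambda>\<gamma>. ?\<phi> (c - b) \<gamma> + ?\<phi> (d - a) \<gamma> - ?\<phi> (d - b) \<gamma> - ?\<phi> (c - a) \<gamma>)
        (\<bar>c - b\<bar> / 2 + \<bar>d - a\<bar> / 2 - \<bar>d - b\<bar> / 2 - \<bar>c - a\<bar> / 2)"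
      by (intro has_bochner_integral_add has_bochner_integral_diff phi)
    have "Re (\<integral>\<gamma>. ?P \<gamma> \<partial>lborel) = (\<integral>\<gamma>. Re (?P \<gamma>) \<partial>lborel)"
      using intP by (rule integral_Re[symmetric])
    also have "\<dots> = (\<integral>\<gamma>. ?\<phi> (c - b) \<gamma> + ?\<phi> (d - a) \<gamma> - ?\<phi> (d - b) \<gamma> - ?\<phi> (c - a) \<gamma> \<partial>lborel)"
    proof (rule integral_cong_AE)
      show "AE \<gamma> in lborel. Re (?P \<gamma>) = ?\<phi> (c - b) \<gamma> + ?\<phi> (d - a) \<gamma> - ?\<phi> (d - b) \<gamma> - ?\<phi> (c - a) \<gamma>"
        using AE0 by eventually_elim (rule Re_fourier_integral_indicator_mult, use True in auto)
    qed measurable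
    also have "\<dots> = \<bar>c - b\<bar> / 2 + \<bar>d - a\<bar> / 2 - \<bar>d - b\<bar> / 2 - \<bar>c - a\<bar> / 2"
      using hb by (rule has_bochner_integral_integral_eq)
    also have "\<dots> = max 0 (min b d - max a c)"
      using True by (auto simp: abs_if min_def max_def field_simps)
    finally show ?thesis
      using Im by (simp add: rhs complex_eq_iff)
  next
    case False
    have "?F a b = (\<lambda>_. 0) \<or> ?F c d = (\<lambda>_. 0)"
      using F0 False by (metis not_le)
    moreover have "min b d \<le> max a c"
      using False by (auto simp: min_le_iff_disj le_max_iff_disj)
    then have "max 0 (min b d - max a c) = 0"
      by (intro max_absorb1 iffD2[OF diff_le_0_iff_le])
    then have "cinner (interval_l2 (a, b)) (interval_l2 (c, d)) = 0"
      by (simp only: rhs of_real_0)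
    ultimately show ?thesis
      by auto
  qed
qed

text \<open>\<open>F\<close> extends the transform of interval indicators and \<open>S\<close> its
  conjugate, the inverse transform. Duality makes \<open>S\<close> adjoint to \<open>F\<close> on
  indicators and, by density in one argument at a time, everywhere. Surjectivity of \<open>F\<close>
  and its integral formula both come from this adjointness.\<close>

lemma plancherel:
  obtains F where "unitary F"
    "\<And>f. integrable lborel f \<Longrightarrow> square_integrable f \<Longrightarrow>
      AE \<gamma> in lborel. rep_l2 (F (abs_l2 f)) \<gamma> = fourier_integral f \<gamma>"
proof -
  let ?F = "\<lambda>a b. fourier_integral (indicator {a..b})"
  define g where "g = (\<lambda>(a, b). abs_l2 (?F a b))"
  define g' where "g' = (\<lambda>(a, b). abs_l2 (\<lambda>\<gamma>. cnj (?F a b \<gamma>)))"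
  note sq = fourier_integral_indicator_isometry(1)
  have sq': "square_integrable (\<lambda>\<gamma>. cnj (?F a b \<gamma>))" for a b
    using sq[of a b] by (simp add: square_integrable_def)
  have g: "cinner (g i) (g j) = cinner (interval_l2 i) (interval_l2 j)" for i j
    by (cases i; cases j)
      (simp add: g_def cinner_abs_l2 sq fourier_integral_indicator_isometry(2))
  have g': "cinner (g' i) (g' j) = cinner (interval_l2 i) (interval_l2 j)" for i j
  proof -
    obtain a b c d where ij: "i = (a, b)" "j = (c, d)"
      by (cases i; cases j)
    have "cinner (g' i) (g' j) = (\<integral>\<gamma>. ?F c d \<gamma> * cnj (?F a b \<gamma>) \<partial>lborel)"
      by (simp add: ij g'_def cinner_abs_l2 sq' mult.commute)
    also have "\<dots> = cinner (interval_l2 j) (interval_l2 i)"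
      by (simp add: ij fourier_integral_indicator_isometry(2))
    also have "\<dots> = cinner (interval_l2 i) (interval_l2 j)"
      by (simp add: ij interval_l2_def cinner_abs_l2 square_integrable_indicator)
        (rule Bochner_Integration.integral_cong, auto simp: indicator_def)
    finally show ?thesis .
  qed
  obtain F where F: "Vector_Spaces.linear scaleC scaleC F" "\<And>x y. cinner (F x) (F y) = cinner x y"
    "\<And>i. F (interval_l2 i) = g i"
    using complex_isometric_extension[OF g dense_interval_l2] by blast
  obtain S where S: "Vector_Spaces.linear scaleC scaleC S" "\<And>x y. cinner (S x) (S y) = cinner x y"
    "\<And>i. S (interval_l2 i) = g' i"
    using complex_isometric_extension[OF g' dense_interval_l2] by blast
  have cis: "cinner (g (a, b)) (interval_l2 (c, d)) = cinner (interval_l2 (a, b)) (g' (c, d))" for a b c d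
  proof -
    have "cinner (g (a, b)) (interval_l2 (c, d)) = (\<integral>\<gamma>. ?F a b \<gamma> * indicator {c..d} \<gamma> \<partial>lborel)"
      by (simp add: g_def cinner_interval_l2_right sq mult.commute)
    also have "\<dots> = (\<integral>x. indicator {a..b} x * ?F c d x \<partial>lborel)"
      by (rule fourier_integral_duality) (rule square_integrable_indicator)+
    also have "\<dots> = cinner (interval_l2 (a, b)) (g' (c, d))"
      by (simp add: g'_def interval_l2_def cinner_abs_l2 square_integrable_indicator sq')
    finally show ?thesis .
  qed
  have bl: "bounded_linear T" if "Vector_Spaces.linear scaleC scaleC T" "\<And>x y. cinner (T x) (T y) = cinner x y"
    for T :: "l2 \<Rightarrow> l2"
  proof -
    interpret T: Vector_Spaces.linear scaleC scaleC T by fact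
    show ?thesis
      by (rule bounded_linear_intro[where K = 1])
        (auto simp: T.add T.scale scaleR_scaleC norm_eq_sqrt_inner inner_eq_Re_cinner that(2))
  qed
  have blF: "bounded_linear F" and blS: "bounded_linear S"
    using bl F S by blast+
  interpret F: Vector_Spaces.linear scaleC scaleC F by fact
  interpret S: Vector_Spaces.linear scaleC scaleC S by fact
  have cis': "cinner (g i) (interval_l2 j) = cinner (interval_l2 i) (g' j)" for i j
    using cis by (cases i; cases j) simp
  have adj1: "cinner (g i) y = cinner (interval_l2 i) (S y)" for i y
  proof -
    have "(\<lambda>y. cinner (g i) y) = (\<lambda>y. cinner (interval_l2 i) (S y))"
      by (rule bounded_linear_eqI_dense[OF bounded_linear_cinner_right
            bounded_linear_compose[OF bounded_linear_cinner_right blS] _ dense_interval_l2])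
        (auto simp: cinner_scaleC_right S.scale S(3) cis')
    then show ?thesis by metis
  qed
  have adj2: "cinner y (g i) = cinner (S y) (interval_l2 i)" for i y
    using adj1[of i y] by (metis cinner_commute)
  have adj: "cinner (F x) y = cinner x (S y)" for x y
  proof -
    have "(\<lambda>x. cinner y (F x)) = (\<lambda>x. cinner (S y) x)"
      by (rule bounded_linear_eqI_dense[OF bounded_linear_compose[OF bounded_linear_cinner_right blF]
          bounded_linear_cinner_right _ dense_interval_l2])
        (auto simp: cinner_scaleC_right F.scale F(3) adj2)
    then show ?thesis by (metis cinner_commute)
  qed
  \<comment> \<open>\<open>cinner (F (S y)) z = cinner (S y) (S z) = cinner y z\<close>, by
    adjointness and the isometry of \<open>S\<close>; hence \<open>F\<close> is onto.\<close>
  have FS: "F (S y) = y" for y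
  proof -
    have "inner (F (S y)) z = inner y z" for z
      by (simp add: inner_eq_Re_cinner adj S(2))
    then have "inner (F (S y) - y) (F (S y) - y) = 0"
      by (simp add: inner_diff_left)
    then show ?thesis by simp
  qed
  show thesis
  proof
    show "unitary F"
      unfolding unitary_def using F(1,2) FS by (metis surjI)
    fix f assume f: "integrable lborel f" "square_integrable f"
    have [measurable]: "f \<in> borel_measurable borel"
      using f(2) by (rule square_integrable_measurable)
    \<comment> \<open>Boundedness makes \<open>fourier_integral f\<close> integrable on bounded
      intervals, so it can be compared with \<open>F (abs_l2 f)\<close> through interval integrals
      before it is known to be square-integrable.\<close>
    have bnd: "cmod (fourier_integral f \<gamma>) \<le> (\<integral>x. cmod (f x) \<partial>lborel)" for \<gamma>
      unfolding fourier_integral_cis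
      by (rule order.trans[OF integral_norm_bound]) (simp add: norm_mult)
    have int: "integrable lborel (\<lambda>x. indicator {a..b} x * fourier_integral f x)" for a b
    proof (rule Bochner_Integration.integrable_bound)
      show "integrable lborel (\<lambda>x. complex_of_real (\<integral>x. cmod (f x) \<partial>lborel) * indicator {a..b} x)"
        by (intro integrable_mult_right square_integrable_indicator)
    qed (use bnd in \<open>auto simp: indicator_def norm_mult intro: order.trans[OF _ abs_ge_self]\<close>)
    have "(\<integral>x. indicator {a..b} x * rep_l2 (F (abs_l2 f)) x \<partial>lborel)
        = (\<integral>x. indicator {a..b} x * fourier_integral f x \<partial>lborel)" for a b
    proof -
      have "(\<integral>x. indicator {a..b} x * rep_l2 (F (abs_l2 f)) x \<partial>lborel) = cinner (F (abs_l2 f)) (interval_l2 (a, b))"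
        using cinner_interval_l2_right(1)[OF square_integrable_rep] by (simp add: abs_rep_l2)
      also have "\<dots> = (\<integral>x. f x * ?F a b x \<partial>lborel)"
        by (simp add: adj S(3) g'_def cinner_abs_l2 f sq')
      also have "\<dots> = (\<integral>x. fourier_integral f x * indicator {a..b} x \<partial>lborel)"
        by (rule fourier_integral_duality[symmetric]) (intro f square_integrable_indicator)+
      finally show ?thesis by (simp add: mult.commute)
    qed
    then have "AE x in lborel. rep_l2 (F (abs_l2 f)) x - fourier_integral f x = 0"
      using int cinner_interval_l2_right(2)[OF square_integrable_rep]
      by (intro AE_eq_0_if_interval_integrals_0) (simp_all add: right_diff_distrib)
    then show "AE x in lborel. rep_l2 (F (abs_l2 f)) x = fourier_integral f x"
      by simp
  qed
qed

lemma unitary_imp_bounded_linear: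
  assumes "unitary F"
  shows "bounded_linear F"
proof -
  interpret F: Vector_Spaces.linear scaleC scaleC F
    using assms by (simp add: unitary_def)
  show ?thesis
    by (rule bounded_linear_intro[where K = 1])
      (use assms in \<open>auto simp: unitary_def F.add F.scale scaleR_scaleC norm_eq_sqrt_inner inner_eq_Re_cinner\<close>)
qed

text \<open>The description by \<open>THE\<close> needs uniqueness: two candidates have the same
  integral formula on interval indicators, whose multiples span a dense subspace.\<close>

lemma fourier_properties:
  shows unitary_fourier: "unitary fourier"
    and fourier_eq_integral: "\<And>f. integrable lborel f \<Longrightarrow> square_integrable f \<Longrightarrow>
      AE \<gamma> in lborel. rep_l2 (fourier (abs_l2 f)) \<gamma> = fourier_integral f \<gamma>"
proof -
  let ?P = "\<lambda>F. unitary F \<and> (\<forall>f. integrable lborel f \<and> square_integrable f \<longrightarrow>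
        (AE \<gamma> in lborel. rep_l2 (F (abs_l2 f)) \<gamma> = fourier_integral f \<gamma>))"
  obtain F where F: "?P F"
    using plancherel by metis
  have "G = F" if G: "?P G" for G
  proof (rule bounded_linear_eqI_dense[OF _ _ _ dense_interval_l2])
    show "bounded_linear G" "bounded_linear F"
      using F G unitary_imp_bounded_linear by blast+
    fix x assume "x \<in> range (\<lambda>(c, i). c *\<^sub>C interval_l2 i)"
    then obtain c a b where x: "x = c *\<^sub>C interval_l2 (a, b)"
      by auto
    have "AE \<gamma> in lborel. rep_l2 (G (interval_l2 (a, b))) \<gamma> = fourier_integral (indicator {a..b}) \<gamma>"
      "AE \<gamma> in lborel. rep_l2 (F (interval_l2 (a, b))) \<gamma> = fourier_integral (indicator {a..b}) \<gamma>"
      using F G square_integrable_indicator[of a b] by (auto simp: interval_l2_def)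
    then have "AE \<gamma> in lborel. rep_l2 (G (interval_l2 (a, b))) \<gamma> = rep_l2 (F (interval_l2 (a, b))) \<gamma>"
      by eventually_elim simp
    then have "G (interval_l2 (a, b)) = F (interval_l2 (a, b))"
      by (simp add: eq_rep_l2_iff)
    then show "G x = F x"
      using F G by (simp add: x unitary_def Vector_Spaces.linear_iff)
  qed
  then have "?P fourier"
    unfolding fourier_def using F by (rule theI[of ?P, rotated])
  then show "unitary fourier" "\<And>f. integrable lborel f \<Longrightarrow> square_integrable f \<Longrightarrow>
      AE \<gamma> in lborel. rep_l2 (fourier (abs_l2 f)) \<gamma> = fourier_integral f \<gamma>"
    by blast+
qed

section \<open>Trigonometric moments, essential supports and bounded intervals\<close>

section \<open>Uniqueness of Fourier coefficients\<close>

lemma integrable_mult_bounded: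
  fixes h u :: "'a \<Rightarrow> complex"
  assumes h: "integrable M h" and [measurable]: "u \<in> borel_measurable M" and K: "\<And>x. cmod (u x) \<le> K"
  shows "integrable M (\<lambda>x. h x * u x)"
proof (rule Bochner_Integration.integrable_bound)
  show "integrable M (\<lambda>x. complex_of_real K * h x)"
    using h by simp
  have "cmod (h x * u x) \<le> cmod (complex_of_real K * h x)" for x
  proof -
    have "cmod (h x) * cmod (u x) \<le> cmod (h x) * \<bar>K\<bar>"
      using K[of x] by (intro mult_left_mono) auto
    then show ?thesis
      by (simp add: norm_mult mult.commute)
  qed
  then show "AE x in M. cmod (h x * u x) \<le> cmod (complex_of_real K * h x)"
    by simp
qed (use borel_measurable_integrable[OF h] in measurable)

text \<open>Stated for all \<open>h\<close> so that products of polynomials need no trigonometric normal form: if \<open>p\<close> preserves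
  vanishing moments and so does \<open>q\<close>, then the statement for \<open>q\<close> applies to \<open>h \<cdot> p\<close>.\<close>

lemma vanishing_moments_real_polynomial_function:
  fixes z :: "real \<Rightarrow> complex"
  assumes p: "real_polynomial_function p" and [measurable]: "z \<in> borel_measurable borel"
    and z: "\<And>x. cmod (z x) = 1"
    and h: "integrable lborel h" "\<And>k::int. (\<integral>x. h x * z x powi k \<partial>lborel) = 0"
  shows "integrable lborel (\<lambda>x. h x * complex_of_real (p (z x))) \<and>
    (\<forall>k::int. (\<integral>x. h x * complex_of_real (p (z x)) * z x powi k \<partial>lborel) = 0)"
  using p h
proof (induction arbitrary: h)
  case (linear f h)
  have [measurable]: "h \<in> borel_measurable borel"
    using linear by (auto dest: borel_measurable_integrable)
  have nz: "z x \<noteq> 0" for x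
    using z[of x] by auto
  have [measurable]: "(\<lambda>x. z x powi k) \<in> borel_measurable borel" for k :: int
    by (cases "k \<ge> 0") (simp_all add: power_int_def)
  have int: "integrable lborel (\<lambda>x. h x * z x powi k)" for k :: int
    by (rule integrable_mult_bounded[OF linear(2), where K = 1]) (simp_all add: norm_power_int z)
  \<comment> \<open>A real-linear \<open>f\<close> on the plane has the form
    \<open>A * w + B * cnj w\<close>, and \<open>cnj w\<close> is the inverse of \<open>w\<close> on
    the unit circle. Multiplying by \<open>f (z x)\<close> therefore only shifts the moments by one
    in either direction.\<close>
  define A B where "A = complex_of_real (f 1) / 2 - \<i> * complex_of_real (f \<i>) / 2"
    and "B = complex_of_real (f 1) / 2 + \<i> * complex_of_real (f \<i>) / 2"
  have f: "complex_of_real (f (z x)) = A * z x powi 1 + B * z x powi (-1)" for x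
  proof -
    have "z x = Re (z x) *\<^sub>R 1 + Im (z x) *\<^sub>R \<i>"
      by (simp add: complex_eq_iff)
    then have "f (z x) = f (Re (z x) *\<^sub>R 1 + Im (z x) *\<^sub>R \<i>)"
      by (rule arg_cong)
    also have "\<dots> = Re (z x) * f 1 + Im (z x) * f \<i>"
      using bounded_linear.linear[OF linear(1)] by (simp only: linear_add linear_cmul real_scaleR_def)
    finally have 1: "f (z x) = Re (z x) * f 1 + Im (z x) * f \<i>" .
    have "complex_of_real (Re w * p + Im w * q)
        = (complex_of_real p / 2 - \<i> * complex_of_real q / 2) * w
          + (complex_of_real p / 2 + \<i> * complex_of_real q / 2) * cnj w" for w p q
      by (simp add: complex_eq_iff field_simps)
    note 2 = this
    have "z x * cnj (z x) = 1"
      using complex_norm_square[of "z x"] by (simp add: z)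
    then have "z x powi (- 1) = cnj (z x)"
      by (simp add: power_int_minus inverse_unique)
    then show ?thesis
      by (simp only: 1 2 A_def B_def power_int_1_right)
  qed
  have eq: "h x * complex_of_real (f (z x)) * z x powi k
      = A * (h x * z x powi (k + 1)) + B * (h x * z x powi (k - 1))" for x and k :: int
    unfolding f using nz[of x] by (simp add: power_int_add power_int_diff power_int_minus field_simps)
  show ?case
  proof (intro conjI allI)
    have "integrable lborel (\<lambda>x. h x * complex_of_real (f (z x)) * z x powi 0)"
      unfolding eq by (intro Bochner_Integration.integrable_add integrable_mult_right int)
    then show "integrable lborel (\<lambda>x. h x * complex_of_real (f (z x)))"
      by simp
    show "(\<integral>x. h x * complex_of_real (f (z x)) * z x powi k \<partial>lborel) = 0" for k
      unfolding eq
      by (subst Bochner_Integration.integral_add) (auto intro!: integrable_mult_right int simp: linear(3))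
  qed
next
  case (const c h)
  have "(\<integral>x. complex_of_real c * (h x * z x powi k) \<partial>lborel) = 0" for k
    using const by (subst integral_mult_right_zero) auto
  then show ?case
    using const by (simp add: ac_simps)
next
  case (add f g h)
  have [measurable]: "h \<in> borel_measurable borel"
    using add by (auto dest: borel_measurable_integrable)
  have [measurable]: "(\<lambda>x. z x powi k) \<in> borel_measurable borel" for k :: int
    by (cases "k \<ge> 0") (simp_all add: power_int_def)
  note f = add(3)[OF add(5,6)] and g = add(4)[OF add(5,6)]
  have int: "integrable lborel (\<lambda>x. h' x * z x powi k)" if "integrable lborel h'" for k :: int and h'
    by (rule integrable_mult_bounded[OF that, where K = 1]) (simp_all add: norm_power_int z)
  have eq: "h x * complex_of_real (f (z x) + g (z x)) * y
    = h x * complex_of_real (f (z x)) * y + h x * complex_of_real (g (z x)) * y" for x y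
    by (simp add: algebra_simps)
  show ?case
  proof (intro conjI allI)
    show "integrable lborel (\<lambda>x. h x * complex_of_real (f (z x) + g (z x)))"
      using eq[of _ 1] f g by simp
    show "(\<integral>x. h x * complex_of_real (f (z x) + g (z x)) * z x powi k \<partial>lborel) = 0" for k
      unfolding eq using f g by (subst Bochner_Integration.integral_add) (auto intro: int)
  qed
next
  case (mult f g h)
  from mult(3)[OF mult(5,6)]
  have "integrable lborel (\<lambda>x. h x * complex_of_real (f (z x)))"
    "\<And>k. (\<integral>x. h x * complex_of_real (f (z x)) * z x powi k \<partial>lborel) = 0"
    by auto
  from mult(4)[OF this] show ?case
    by (simp add: mult.assoc)
qed

text \<open>\<open>z\<close> winds one period once around the circle. Vanishing coefficients give
  integral 0 against real polynomials in \<open>z\<close>, by Stone-Weierstrass against continuous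
  functions of \<open>z\<close>, and in the limit against indicators of arcs, that is, of intervals
  within the period. Integrability is the right hypothesis because \<open>h\<close> will be a
  product of two square-integrable functions.\<close>

lemma AE_eq_0_if_fourier_coefficients_0:
  fixes h :: "real \<Rightarrow> complex"
  assumes L: "L > 0" and h: "integrable lborel h"
    and supp: "AE x in lborel. x \<notin> {s..s + L} \<longrightarrow> h x = 0"
    and coeff: "\<And>k::int. (\<integral>x. h x * cis (2 * pi * of_int k * x / L) \<partial>lborel) = 0"
  shows "AE x in lborel. h x = 0"
proof (rule AE_eq_0_if_interval_integrals_0_integrable[OF h])
  fix a b :: real
  define z where "z x = cis (2 * pi * x / L)" for x
  have [measurable]: "z \<in> borel_measurable borel"
    unfolding z_def by measurable
  have [measurable]: "h \<in> borel_measurable borel"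
    using h by (auto dest: borel_measurable_integrable)
  have cmod_z: "cmod (z x) = 1" for x
    by (simp add: z_def)
  have z_powi: "z x powi k = cis (2 * pi * of_int k * x / L)" for x and k :: int
    by (simp add: z_def cis_power_int ac_simps)
  have zero: "(\<integral>x. h x * complex_of_real (\<phi> (z x)) \<partial>lborel) = 0"
    if \<phi>: "continuous_on UNIV \<phi>" for \<phi> :: "complex \<Rightarrow> real"
  proof -
    have [measurable]: "\<phi> \<in> borel_measurable borel"
      using \<phi> by (rule borel_measurable_continuous_onI)
    have "compact (\<phi> ` sphere 0 1)"
      using \<phi> by (intro compact_continuous_image) (auto intro: continuous_on_subset)
    then have "bounded (\<phi> ` sphere 0 1)"
      by (rule compact_imp_bounded)
    then obtain K where "\<forall>w\<in>\<phi> ` sphere 0 1. norm w \<le> K"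
      unfolding bounded_iff by blast
    then have K: "\<bar>\<phi> (z x)\<bar> \<le> K" for x
      by (simp add: cmod_z)
    have int\<phi>: "integrable lborel (\<lambda>x. h x * complex_of_real (\<phi> (z x)))"
      by (rule integrable_mult_bounded[OF h, where K = K]) (simp_all add: K)
    \<comment> \<open>A polynomial within \<open>e\<close> of \<open>\<phi>\<close> on the circle
      integrates to 0 against \<open>h\<close>, so the error is at most \<open>e\<close> times the
      integral of \<open>cmod (h x)\<close>; later \<open>e\<close> tends to 0.\<close>
    have "cmod (\<integral>x. h x * complex_of_real (\<phi> (z x)) \<partial>lborel) \<le> e * (\<integral>x. cmod (h x) \<partial>lborel)" if e: "e > 0" for e
    proof -
      obtain p where p: "real_polynomial_function p" "\<And>x. x \<in> sphere 0 1 \<Longrightarrow> \<bar>\<phi> x - p x\<bar> < e"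
        using Stone_Weierstrass_real_polynomial_function[of "sphere 0 1" \<phi> e]
          continuous_on_subset[OF \<phi> subset_UNIV] compact_sphere e by blast
      note P = vanishing_moments_real_polynomial_function[OF p(1) _ cmod_z h coeff[folded z_powi]]
      have intp: "integrable lborel (\<lambda>x. h x * complex_of_real (p (z x)))"
        and p0: "(\<integral>x. h x * complex_of_real (p (z x)) \<partial>lborel) = 0"
        using P by (auto dest: spec[of _ 0])
      have "(\<integral>x. h x * complex_of_real (\<phi> (z x)) \<partial>lborel)
          = (\<integral>x. h x * complex_of_real (\<phi> (z x)) - h x * complex_of_real (p (z x)) \<partial>lborel)"
        using int\<phi> intp p0 by simp
      also have "cmod \<dots> \<le> (\<integral>x. e * cmod (h x) \<partial>lborel)"
      proof (rule Bochner_Integration.integral_norm_bound_integral)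
        show "cmod (h x * complex_of_real (\<phi> (z x)) - h x * complex_of_real (p (z x))) \<le> e * cmod (h x)" for x
        proof -
          have "cmod (h x * complex_of_real (\<phi> (z x)) - h x * complex_of_real (p (z x)))
              = cmod (h x * complex_of_real (\<phi> (z x) - p (z x)))"
            by (simp add: algebra_simps)
          also have "\<dots> \<le> cmod (h x) * e"
            unfolding norm_mult norm_of_real using p(2)[of "z x"] cmod_z[of x]
            by (intro mult_left_mono) auto
          finally show ?thesis by (simp add: mult.commute)
        qed
      qed (use h int\<phi> intp in auto)
      finally show ?thesis by simp
    qed
    note bound = this
    have "cmod (\<integral>x. h x * complex_of_real (\<phi> (z x)) \<partial>lborel) \<le> 0"
    proof (rule tendsto_lowerbound)
      show "((\<lambda>e. e * (\<integral>x. cmod (h x) \<partial>lborel)) \<longlongrightarrow> 0) (at_right 0)"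
        by (auto intro!: tendsto_eq_intros)
      show "\<forall>\<^sub>F e in at_right 0. cmod (\<integral>x. h x * complex_of_real (\<phi> (z x)) \<partial>lborel) \<le> e * (\<integral>x. cmod (h x) \<partial>lborel)"
        using eventually_at_right_less[of 0] by eventually_elim (rule bound)
    qed simp
    then show ?thesis by simp
  qed
  define J where "J = {max a s..min b (s + L)}"
  show "(\<integral>x. indicator {a..b} x * h x \<partial>lborel) = 0"
  proof (cases "J = {}")
    case True
    have "(\<integral>x. indicator {a..b} x * h x \<partial>lborel) = (\<integral>x. 0 \<partial>(lborel :: real measure))"
    proof (rule integral_cong_AE)
      show "AE x in lborel. indicator {a..b} x * h x = 0"
        using supp by eventually_elim (use True in \<open>auto simp: J_def indicator_def\<close>)
    qed auto
    then show ?thesis by simp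
  next
    case False
    have "compact (z ` J)"
      unfolding z_def J_def by (intro compact_continuous_image continuous_intros) (use L in auto)
    then have clA: "closed (z ` J)" by (rule compact_imp_closed)
    \<comment> \<open>Continuous functions on the circle decreasing to the indicator of the arc \<open>z ` J\<close>.\<close>
    define \<phi> where "\<phi> n w = max 0 (1 - real n * infdist w (z ` J))" for n w
    have "(\<lambda>n. \<integral>x. h x * complex_of_real (\<phi> n (z x)) \<partial>lborel) \<longlonglongrightarrow> (\<integral>x. indicator {a..b} x * h x \<partial>lborel)"
    proof (rule integral_dominated_convergence[where w = "\<lambda>x. cmod (h x)"])
      have [measurable]: "\<phi> n \<in> borel_measurable borel" for n
        unfolding \<phi>_def by (intro borel_measurable_continuous_onI continuous_intros)
      show "(\<lambda>x. h x * complex_of_real (\<phi> n (z x))) \<in> borel_measurable lborel" for n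
        by measurable
      show "AE x in lborel. cmod (h x * complex_of_real (\<phi> n (z x))) \<le> cmod (h x)" for n
        by (auto simp: norm_mult \<phi>_def infdist_nonneg intro!: mult_left_le)
      \<comment> \<open>The endpoints \<open>s\<close> and \<open>s + L\<close> are the same point
        of the circle, so they are removed before \<open>z\<close> is used to separate
        points.\<close>
      have "AE x in lborel. x \<noteq> s" "AE x in lborel. x \<noteq> s + L"
        by (rule AE_lborel_singleton)+
      then show "AE x in lborel. (\<lambda>n. h x * complex_of_real (\<phi> n (z x))) \<longlonglongrightarrow> indicator {a..b} x * h x"
        using supp
      proof eventually_elim
        case (elim x)
        show ?case
        proof (cases "h x = 0")
          case False
          with elim have x: "s < x" "x < s + L" by auto
          show ?thesis
          proof (cases "x \<in> J")
            case True
            then have "\<phi> n (z x) = 1" for n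
              by (simp add: \<phi>_def)
            then show ?thesis
              using True by (simp add: J_def indicator_def)
          next
            case xJ: False
            \<comment> \<open>The interior point \<open>x\<close> and a point \<open>y\<close> of
              the closed period differ by less than \<open>L\<close>, so equal values of
              \<open>z\<close> leave only the integer \<open>n = 0\<close>.\<close>
            have "z x \<notin> z ` J"
            proof
              assume "z x \<in> z ` J"
              then obtain y where y: "y \<in> J" "z x = z y" by auto
              then obtain n :: int where "2 * pi * x / L = 2 * pi * y / L + 2 * pi * of_int n"
                using sin_cos_eq_iff[of "2 * pi * x / L" "2 * pi * y / L"]
                by (auto simp: z_def complex_eq_iff)
              then have "2 * pi * x = 2 * pi * (y + of_int n * L)"
                using L by (simp add: field_simps)
              then have n: "x = y + of_int n * L"
                by (subst (asm) mult_cancel_left) simp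
              then have n': "x - y = of_int n * L"
                by simp
              have "\<bar>x - y\<bar> < L"
                using x y(1) by (auto simp: J_def)
              then have "\<bar>of_int n\<bar> * L < 1 * L"
                using L by (simp add: n' abs_mult)
              then have "\<bar>real_of_int n\<bar> < 1"
                using L by (simp only: mult_less_cancel_right_pos)
              then have "n = 0" by linarith
              then show False using n' y xJ by simp
            qed
            then have d: "infdist (z x) (z ` J) > 0"
              using clA \<open>J \<noteq> {}\<close> infdist_pos_not_in_closed[OF clA] by auto
            obtain n where n: "1 / infdist (z x) (z ` J) < real n"
              using reals_Archimedean2 by blast
            have "\<forall>\<^sub>F m in sequentially. indicator {a..b} x * h x = h x * complex_of_real (\<phi> m (z x))"
              using eventually_ge_at_top[of n]
            proof eventually_elim
              case (elim m)
              have "1 / infdist (z x) (z ` J) < real m"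
                using n elim by linarith
              then have "1 < real m * infdist (z x) (z ` J)"
                using d by (simp add: field_simps)
              then have "\<phi> m (z x) = 0"
                by (simp add: \<phi>_def)
              then show ?case
                using xJ x by (auto simp: J_def indicator_def)
            qed
            then show ?thesis
              by (rule Lim_transform_eventually[OF tendsto_const])
          qed
        qed simp
      qed
    qed (use h in auto)
    moreover have "(\<integral>x. h x * complex_of_real (\<phi> n (z x)) \<partial>lborel) = 0" for n
      unfolding \<phi>_def by (intro zero continuous_intros)
    ultimately show ?thesis
      using LIMSEQ_unique[OF _ tendsto_const] by simp
  qed
qed

text \<open>The defining union may be uncountable, while null sets only add up countably; Lindelof's
  theorem extracts a countable subfamily with the same union.\<close>

lemma AE_eq_0_outside_essential_support: "AE x in lborel. x \<notin> essential_support f \<longrightarrow> f x = 0"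
proof -
  define \<V> where "\<V> = {U. open U \<and> (AE x in lborel. x \<in> U \<longrightarrow> f x = 0)}"
  have "\<And>S. S \<in> \<V> \<Longrightarrow> open S"
    by (simp add: \<V>_def)
  then obtain \<U> where \<U>: "\<U> \<subseteq> \<V>" "countable \<U>" "\<Union>\<U> = \<Union>\<V>"
    by (rule Lindelof)
  have "AE x in lborel. x \<in> U \<longrightarrow> f x = 0" if "U \<in> \<U>" for U
    using that \<U>(1) by (auto simp: \<V>_def)
  then have "AE x in lborel. \<forall>U\<in>\<U>. x \<in> U \<longrightarrow> f x = 0"
    by (subst AE_ball_countable[OF \<U>(2)]) blast
  then show ?thesis
  proof eventually_elim
    case (elim x)
    have "essential_support f = - \<Union>\<U>"
      unfolding essential_support_def \<U>(3) \<V>_def ..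
    then show ?case
      using elim by blast
  qed
qed

text \<open>Replaces \<open>I\<close>, whichever endpoints it contains, by a compact interval of the
  same length: the open interval from \<open>Inf I\<close> to \<open>Sup I\<close> lies in
  \<open>I\<close>, so its length is at most the measure.\<close>

lemma bounded_interval_subset_Icc_measure:
  fixes I :: "real set"
  assumes I: "is_interval I" "bounded I" and pos: "measure lborel I > 0"
  obtains s where "I \<subseteq> {s..s + measure lborel I}"
proof -
  have ne: "I \<noteq> {}" using pos by auto
  have bdd: "bdd_below I" "bdd_above I"
    using I(2) bounded_imp_bdd_below bounded_imp_bdd_above by auto
  define s t where "s = Inf I" and "t = Sup I"
  have sub: "I \<subseteq> {s..t}"
    using bdd by (auto simp: s_def t_def intro: cInf_lower cSup_upper)
  have sup: "{s<..<t} \<subseteq> I"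
  proof
    fix x assume x: "x \<in> {s<..<t}"
    obtain y y' where "y \<in> I" "y < x" "y' \<in> I" "x < y'"
      using x ne bdd by (auto simp: s_def t_def cInf_less_iff less_cSup_iff)
    then show "x \<in> I"
      using I(1) unfolding is_interval_1 by (meson less_imp_le)
  qed
  have "I = {s<..<t} \<union> (I \<inter> {s, t})"
    using sub sup by fastforce
  then have "I \<in> sets borel"
    by (metis finite_Int finite.intros borel_open open_greaterThanLessThan sets.Un finite_imp_closed borel_closed)
  moreover have "emeasure lborel I < \<infinity>"
    using I(2) by (rule emeasure_bounded_finite)
  ultimately have "measure lborel {s<..<t} \<le> measure lborel I"
    using sup by (intro measure_mono_fmeasurable) (auto simp: fmeasurable_def)
  moreover have "s \<le> t"
    using sub ne by force
  ultimately have "t \<le> s + measure lborel I"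
    by simp
  then show thesis
    using sub by (intro that[of s]) auto
qed

section \<open>Dilations and translations under the Fourier transform, and membership in the wavelet
  spaces\<close>

section \<open>Wavelet spaces on the Fourier side\<close>

lemma l2_cases:
  obtains g where "square_integrable g" "f = abs_l2 g"
  by (rule that[OF square_integrable_rep[of f]]) (simp add: abs_rep_l2)

lemma bounded_linear_l2I:
  assumes T: "\<And>g. square_integrable g \<Longrightarrow> square_integrable (T g)"
    and F: "\<And>g. square_integrable g \<Longrightarrow> F (abs_l2 g) = abs_l2 (T g)"
    and add: "\<And>f g. T (\<lambda>x. f x + g x) = (\<lambda>x. T f x + T g x)"
    and cmult: "\<And>c f. T (\<lambda>x. c * f x) = (\<lambda>x. c * T f x)"
    and norm: "\<And>g. square_integrable g \<Longrightarrow> (\<integral>x. (cmod (T g x))\<^sup>2 \<partial>lborel) = (\<integral>x. (cmod (g x))\<^sup>2 \<partial>lborel)"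
  shows "bounded_linear F"
proof (rule bounded_linear_intro[where K = 1])
  fix f g :: l2 and r :: real
  obtain f' g' where f': "square_integrable f'" "f = abs_l2 f'" and g': "square_integrable g'" "g = abs_l2 g'"
    by (metis l2_cases)
  show "F (f + g) = F f + F g"
    by (simp add: f' g' plus_abs_l2 F T square_integrable_add add)
  show "F (r *\<^sub>R f) = r *\<^sub>R F f"
    by (simp add: f' scaleR_scaleC scaleC_abs_l2 F T square_integrable_cmult cmult)
  show "norm (F f) \<le> norm f * 1"
    by (simp add: f' F T norm_abs_l2 norm)
qed

lemma dilation_abs_l2:
  assumes "square_integrable g"
  shows "dilation c (abs_l2 g) = abs_l2 (\<lambda>x. complex_of_real (sqrt c) * g (c * x))"
  using assms by (intro dilation.abs_eq) (auto simp: l2_rel_def)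

lemma translation_abs_l2:
  assumes "square_integrable g"
  shows "translation t (abs_l2 g) = abs_l2 (\<lambda>x. g (x - t))"
  using assms by (intro translation.abs_eq) (auto simp: l2_rel_def)

lemma square_integrable_dilation:
  assumes "square_integrable g" "c \<noteq> 0"
  shows "square_integrable (\<lambda>x. g (c * x))"
  using square_integrable_affine[OF assms, of 0] by simp

lemma square_integrable_translation:
  assumes "square_integrable g"
  shows "square_integrable (\<lambda>x. g (x - t))"
  using square_integrable_affine[OF assms, of 1 "- t"] by simp

lemma square_integrable_mult_unimodular:
  assumes "square_integrable g" "u \<in> borel_measurable borel" "\<And>x. cmod (u x) = 1"
  shows "square_integrable (\<lambda>x. u x * g x)"
  using assms square_integrable_measurable[OF assms(1)] borel_measurable_times[of u borel g]
  by (simp add: square_integrable_def norm_mult)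

lemma bounded_linear_dilation:
  assumes "c > 0"
  shows "bounded_linear (dilation c)"
proof (rule bounded_linear_l2I)
  show "square_integrable (\<lambda>x. complex_of_real (sqrt c) * g (c * x))" if "square_integrable g" for g
    using that assms by (intro square_integrable_cmult square_integrable_dilation) auto
  show "(\<integral>x. (cmod (complex_of_real (sqrt c) * g (c * x)))\<^sup>2 \<partial>lborel) = (\<integral>x. (cmod (g x))\<^sup>2 \<partial>lborel)"
    if "square_integrable g" for g
    using lborel_integral_real_affine[of c "\<lambda>x. (cmod (g x))\<^sup>2" 0] assms
    by (simp add: norm_mult power_mult_distrib)
qed (auto simp: dilation_abs_l2 algebra_simps)

lemma bounded_linear_translation: "bounded_linear (translation t)"
proof (rule bounded_linear_l2I)
  show "(\<integral>x. (cmod (g (x - t)))\<^sup>2 \<partial>lborel) = (\<integral>x. (cmod (g x))\<^sup>2 \<partial>lborel)" for g :: "real \<Rightarrow> complex"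
    using lborel_integral_real_affine[of 1 "\<lambda>x. (cmod (g x))\<^sup>2" "- t"] by simp
qed (auto simp: translation_abs_l2 square_integrable_translation)

lemma bounded_linear_mult_unimodular:
  assumes u: "u \<in> borel_measurable borel" "\<And>x. cmod (u x) = 1"
  shows "bounded_linear (\<lambda>g. abs_l2 (\<lambda>x. u x * rep_l2 g x))"
proof (rule bounded_linear_l2I)
  fix g assume g: "square_integrable g"
  show "abs_l2 (\<lambda>x. u x * rep_l2 (abs_l2 g) x) = abs_l2 (\<lambda>x. u x * g x)"
  proof (subst abs_l2_eq_iff)
    show "AE x in lborel. u x * rep_l2 (abs_l2 g) x = u x * g x"
      using rep_abs_l2[OF g] by eventually_elim simp
  qed (intro square_integrable_mult_unimodular square_integrable_rep g u)+
  show "square_integrable (\<lambda>x. u x * g x)"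
    by (intro square_integrable_mult_unimodular g u)
qed (auto simp: u norm_mult algebra_simps)

lemma fourier_abs_l2:
  assumes "integrable lborel f" "square_integrable f" "square_integrable (fourier_integral f)"
  shows "fourier (abs_l2 f) = abs_l2 (fourier_integral f)"
  using abs_l2_eq_iff[OF square_integrable_rep assms(3)] fourier_eq_integral[OF assms(1,2)]
  by (simp add: abs_rep_l2)

text \<open>Substituting \<open>y = c * x - t\<close> turns the kernel at \<open>\<gamma>\<close>
  into the kernel at \<open>\<gamma> / c\<close> times a phase depending on \<open>t\<close>; the
  Jacobian changes \<open>sqrt c\<close> into \<open>sqrt c / c = sqrt (1 / c)\<close>.\<close>

lemma fourier_integral_affine:
  assumes "c > 0"
  shows "fourier_integral (\<lambda>x. complex_of_real (sqrt c) * f (c * x - t)) \<gamma>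
    = cis (- (2 * pi * t * (\<gamma> / c))) * (complex_of_real (sqrt (1 / c)) * fourier_integral f (1 / c * \<gamma>))"
proof -
  let ?G = "\<lambda>y. f y * cis (- (2 * pi * (y * (1 / c * \<gamma>)))) * cis (- (2 * pi * t * (\<gamma> / c)))"
  have G: "?G (- t + c * x) = f (c * x - t) * cis (- (2 * pi * (x * \<gamma>)))" for x
  proof -
    have "- (2 * pi * ((- t + c * x) * (1 / c * \<gamma>))) + - (2 * pi * t * (\<gamma> / c)) = - (2 * pi * (x * \<gamma>))"
      using assms by (simp add: field_simps)
    then show ?thesis
      by (simp only: mult.assoc cis_mult) simp
  qed
  have "sqrt c / c = sqrt (1 / c)"
    using assms by (simp add: real_sqrt_divide real_div_sqrt field_simps)
  then have sqrt: "complex_of_real (sqrt c) / complex_of_real c = complex_of_real (sqrt (1 / c))"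
    by (metis of_real_divide)
  have "fourier_integral f (1 / c * \<gamma>) * cis (- (2 * pi * t * (\<gamma> / c))) = (\<integral>y. ?G y \<partial>lborel)"
    unfolding fourier_integral_cis by (rule integral_mult_left_zero[symmetric])
  also have "\<dots> = \<bar>c\<bar> *\<^sub>R (\<integral>x. ?G (- t + c * x) \<partial>lborel)"
    using assms by (intro lborel_integral_real_affine) simp
  also have "\<dots> = complex_of_real c * (\<integral>x. f (c * x - t) * cis (- (2 * pi * (x * \<gamma>))) \<partial>lborel)"
    unfolding G using assms by (simp add: scaleR_conv_of_real)
  finally have "(\<integral>x. f (c * x - t) * cis (- (2 * pi * (x * \<gamma>))) \<partial>lborel)
      = fourier_integral f (1 / c * \<gamma>) * cis (- (2 * pi * t * (\<gamma> / c))) / complex_of_real c"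
    using assms by (simp add: field_simps)
  moreover have "fourier_integral (\<lambda>x. complex_of_real (sqrt c) * f (c * x - t)) \<gamma>
      = complex_of_real (sqrt c) * (\<integral>x. f (c * x - t) * cis (- (2 * pi * (x * \<gamma>))) \<partial>lborel)"
    unfolding fourier_integral_cis mult.assoc by (rule integral_mult_right_zero)
  ultimately show ?thesis
    by (simp only: sqrt[symmetric]) (simp add: ac_simps)
qed

text \<open>Both sides are bounded and linear in \<open>f\<close>, so they are compared on multiples
  of interval indicators, where the Fourier integral computes the transform. The square
  integrability lets inner products with the class be evaluated as integrals.\<close>

lemma fourier_dilation_translation:
  fixes c t :: real and f :: l2
  assumes c: "c > 0"
  defines "B \<equiv> \<lambda>g \<gamma>. cis (- (2 * pi * t * (\<gamma> / c))) * (complex_of_real (sqrt (1 / c)) * g (1 / c * \<gamma>))"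
  shows "fourier (dilation c (translation t f)) = abs_l2 (B (rep_l2 (fourier f)))" (is ?eq)
    and "square_integrable (B (rep_l2 (fourier f)))" (is ?sq)
proof -
  let ?u = "\<lambda>\<gamma>. cis (- (2 * pi * t * (\<gamma> / c)))"
  have u: "?u \<in> borel_measurable borel" "\<And>x. cmod (?u x) = 1"
    by simp_all
  have sqd: "square_integrable (\<lambda>\<gamma>. complex_of_real (sqrt (1 / c)) * g (1 / c * \<gamma>))"
    if "square_integrable g" for g
    using that c by (intro square_integrable_cmult square_integrable_dilation) auto
  have sqB: "square_integrable (B g)" if "square_integrable g" for g
    unfolding B_def by (intro square_integrable_mult_unimodular sqd that u)
  then show ?sq
    by (simp add: square_integrable_rep)
  let ?M = "\<lambda>g. abs_l2 (\<lambda>x. ?u x * rep_l2 g x)"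
  have M: "?M (dilation (1 / c) (abs_l2 g)) = abs_l2 (B g)" if "square_integrable g" for g
  proof -
    let ?d = "\<lambda>\<gamma>. complex_of_real (sqrt (1 / c)) * g (1 / c * \<gamma>)"
    have "?M (abs_l2 ?d) = abs_l2 (B g)"
    proof (subst abs_l2_eq_iff)
      show "AE x in lborel. ?u x * rep_l2 (abs_l2 ?d) x = B g x"
        using rep_abs_l2[OF sqd[OF that]] by eventually_elim (simp add: B_def)
    qed (intro square_integrable_mult_unimodular square_integrable_rep sqB that u)+
    then show ?thesis
      by (simp add: dilation_abs_l2[OF that])
  qed
  have F: "bounded_linear fourier"
    using unitary_fourier by (rule unitary_imp_bounded_linear)
  have "(\<lambda>f. fourier (dilation c (translation t f))) = (\<lambda>f. ?M (dilation (1 / c) (fourier f)))"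
  proof (rule bounded_linear_eqI_dense[OF _ _ _ dense_interval_l2])
    show "bounded_linear (\<lambda>f. fourier (dilation c (translation t f)))"
      using c by (intro bounded_linear_compose[OF F] bounded_linear_compose[OF bounded_linear_dilation]
          bounded_linear_translation)
    show "bounded_linear (\<lambda>f. ?M (dilation (1 / c) (fourier f)))"
      using c by (intro bounded_linear_compose[OF bounded_linear_mult_unimodular[OF u]]
          bounded_linear_compose[OF bounded_linear_dilation] F) simp_all
    fix x assume "x \<in> range (\<lambda>(k, i). k *\<^sub>C interval_l2 i)"
    then obtain k p q where x: "x = k *\<^sub>C interval_l2 (p, q)"
      by auto
    define f where "f x = k * indicator {p..q} x" for x :: real
    have sqf: "square_integrable f" and intf: "integrable lborel f"
      unfolding f_def by (intro square_integrable_cmult integrable_mult_right square_integrable_indicator)+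
    have xf: "x = abs_l2 f"
      by (simp add: x f_def[abs_def] interval_l2_def scaleC_abs_l2 square_integrable_indicator)
    have "fourier_integral f \<gamma> = k * fourier_integral (indicator {p..q}) \<gamma>" for \<gamma>
      unfolding fourier_integral_cis f_def mult.assoc by (rule integral_mult_right_zero)
    then have "fourier_integral f = (\<lambda>\<gamma>. k * fourier_integral (indicator {p..q}) \<gamma>)"
      by (rule ext)
    then have sqF: "square_integrable (fourier_integral f)"
      by (simp add: square_integrable_cmult fourier_integral_indicator_isometry(1))
    let ?g = "\<lambda>x. complex_of_real (sqrt c) * f (c * x - t)"
    have g: "square_integrable ?g"
      using square_integrable_affine[OF sqf, of c "- t"] c by (auto intro: square_integrable_cmult)
    have intg: "integrable lborel ?g"
      using lborel_integrable_real_affine[OF intf, of c "- t"] c by simp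
    have Bg: "fourier_integral ?g = B (fourier_integral f)"
      unfolding B_def using fourier_integral_affine[OF c] by (intro ext) simp
    have "fourier (dilation c (translation t x)) = fourier (abs_l2 ?g)"
      by (simp add: xf translation_abs_l2 sqf dilation_abs_l2 square_integrable_translation)
    also have "\<dots> = abs_l2 (B (fourier_integral f))"
      using fourier_abs_l2[OF intg g] sqB[OF sqF] by (simp add: Bg)
    also have "\<dots> = ?M (dilation (1 / c) (fourier x))"
      by (simp only: M[OF sqF] xf fourier_abs_l2[OF intf sqf sqF])
    finally show "fourier (dilation c (translation t x)) = ?M (dilation (1 / c) (fourier x))" .
  qed
  then have "fourier (dilation c (translation t f)) = ?M (dilation (1 / c) (abs_l2 (rep_l2 (fourier f))))"
    by (metis abs_rep_l2)
  then show ?eq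
    by (simp only: M[OF square_integrable_rep])
qed

text \<open>The residue \<open>q\<close> of the projection is orthogonal to all generators, which
  makes its transform \<open>Q\<close> vanish wherever the dilated \<open>\<Psi>\<close> does not.
  The transform of \<open>f\<close> lives there up to a null set, so \<open>q\<close> is orthogonal
  to \<open>f\<close>, to \<open>p\<close> and hence to itself.\<close>

lemma band_limited_in_wavelet_space:
  fixes \<psi> f :: l2
  assumes I: "I \<subseteq> {s..s + m}" and supp: "essential_support (rep_l2 (fourier \<psi>)) \<subseteq> I"
    and b: "0 < b" "b * m \<le> 1" and a: "a > 0"
    and nz: "AE \<gamma> in lborel. 0 < \<bar>\<gamma>\<bar> \<and> \<bar>\<gamma>\<bar> < r \<longrightarrow> rep_l2 (fourier \<psi>) \<gamma> \<noteq> 0"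
    and f: "AE \<gamma> in lborel. r * a powi j \<le> \<bar>\<gamma>\<bar> \<longrightarrow> rep_l2 (fourier f) \<gamma> = 0"
  shows "f \<in> wavelet_space a b \<psi> j"
proof -
  define c where "c = a powi j"
  have c: "c > 0" using a by (simp add: c_def)
  let ?M = "wavelet_space a b \<psi> j"
  have M: "csubspace ?M"
    unfolding wavelet_space_def by (intro csubspace_closure) simp
  have "closed ?M"
    by (simp add: wavelet_space_def)
  then obtain p where p: "p \<in> ?M" "\<And>x. x \<in> ?M \<Longrightarrow> inner (f - p) x = 0"
    using orthogonal_projection_exists[OF csubspace_imp_subspace[OF M]] by metis
  define q where "q = f - p"
  have q: "cinner q x = 0" if "x \<in> ?M" for x
    using cinner_eq_0_csubspace[OF M p(2) that] by (simp add: q_def)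
  define \<Psi> Q where "\<Psi> = rep_l2 (fourier \<psi>)" and "Q = rep_l2 (fourier q)"
  have sq: "square_integrable \<Psi>" "square_integrable Q"
    by (simp_all add: \<Psi>_def Q_def square_integrable_rep)
  have [measurable]: "\<Psi> \<in> borel_measurable borel"
    using sq(1) by (rule square_integrable_measurable)
  have unit: "cinner (fourier x) (fourier y) = cinner x y" for x y
    using unitary_fourier by (simp add: unitary_def)
  \<comment> \<open>Up to a constant factor, the inner products of \<open>q\<close> with the
    generators are Fourier coefficients of \<open>h\<close>.\<close>
  define h where "h \<gamma> = Q \<gamma> * cnj (\<Psi> (1 / c * \<gamma>))" for \<gamma>
  have inth: "integrable lborel h"
    unfolding h_def using c by (intro integrable_mult_cnj sq square_integrable_dilation) auto
  have h0: "AE \<gamma> in lborel. h \<gamma> = 0"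
  proof (rule AE_eq_0_if_fourier_coefficients_0[OF _ inth])
    \<comment> \<open>Translation by \<open>k * b\<close> followed by dilation by \<open>c\<close>
      yields exponentials of period \<open>c / b\<close>; the dilated \<open>\<Psi>\<close> lives on
      an interval of length \<open>c * m\<close>, which fits into one period because
      \<open>b * m \<le> 1\<close>.\<close>
    show "c / b > 0"
      using b c by simp
    have "AE x in lborel. x \<notin> {s..s + m} \<longrightarrow> \<Psi> x = 0"
      using AE_eq_0_outside_essential_support[of \<Psi>]
      by eventually_elim (use I supp in \<open>auto simp: \<Psi>_def\<close>)
    then have "AE \<gamma> in lborel. 0 + 1 / c * \<gamma> \<notin> {s..s + m} \<longrightarrow> \<Psi> (0 + 1 / c * \<gamma>) = 0"
      using c by (intro AE_borel_affine[where P = "\<lambda>x. x \<notin> {s..s + m} \<longrightarrow> \<Psi> x = 0"]) auto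
    then show "AE \<gamma> in lborel. \<gamma> \<notin> {c * s..c * s + c / b} \<longrightarrow> h \<gamma> = 0"
    proof eventually_elim
      case (elim \<gamma>)
      show ?case
      proof
        assume \<gamma>: "\<gamma> \<notin> {c * s..c * s + c / b}"
        have "m \<le> 1 / b"
          using b by (simp add: field_simps)
        then have "c * m \<le> c / b"
          using c mult_left_mono[of m "1 / b" c] by simp
        then have "0 + 1 / c * \<gamma> \<notin> {s..s + m}"
          using \<gamma> c by (auto simp: field_simps)
        then show "h \<gamma> = 0"
          using elim by (simp add: h_def)
      qed
    qed
    fix k :: int
    let ?v = "dilation c (translation (of_int k * b) \<psi>)"
    let ?V = "\<lambda>\<gamma>. cis (- (2 * pi * (of_int k * b) * (\<gamma> / c))) * (complex_of_real (sqrt (1 / c)) * \<Psi> (1 / c * \<gamma>))"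
    have "?v \<in> ?M"
      unfolding wavelet_space_def c_def
      by (intro closure_subset[THEN subsetD] complex_vector.span_base) auto
    then have "0 = cinner (fourier q) (fourier ?v)"
      by (simp add: unit q)
    also have "\<dots> = cinner (abs_l2 Q) (abs_l2 ?V)"
      using fourier_dilation_translation(1)[OF c] by (simp add: Q_def abs_rep_l2 \<Psi>_def)
    also have "\<dots> = (\<integral>\<gamma>. Q \<gamma> * cnj (?V \<gamma>) \<partial>lborel)"
      using fourier_dilation_translation(2)[OF c] by (intro cinner_abs_l2 sq) (simp add: \<Psi>_def)
    also have "\<dots> = (\<integral>\<gamma>. complex_of_real (sqrt (1 / c)) * (h \<gamma> * cis (2 * pi * of_int k * \<gamma> / (c / b))) \<partial>lborel)"
      by (intro Bochner_Integration.integral_cong) (simp_all add: h_def cis_cnj ac_simps)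
    also have "\<dots> = complex_of_real (sqrt (1 / c)) * (\<integral>\<gamma>. h \<gamma> * cis (2 * pi * of_int k * \<gamma> / (c / b)) \<partial>lborel)"
      by (rule integral_mult_right_zero)
    finally show "(\<integral>\<gamma>. h \<gamma> * cis (2 * pi * of_int k * \<gamma> / (c / b)) \<partial>lborel) = 0"
      using c by simp
  qed
  have "AE \<gamma> in lborel. 0 < \<bar>0 + 1 / c * \<gamma>\<bar> \<and> \<bar>0 + 1 / c * \<gamma>\<bar> < r \<longrightarrow> \<Psi> (0 + 1 / c * \<gamma>) \<noteq> 0"
    using nz[folded \<Psi>_def] c
    by (intro AE_borel_affine[where P = "\<lambda>\<gamma>. 0 < \<bar>\<gamma>\<bar> \<and> \<bar>\<gamma>\<bar> < r \<longrightarrow> \<Psi> \<gamma> \<noteq> 0"]) auto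
  moreover have "AE \<gamma> in lborel. \<gamma> \<noteq> (0::real)"
    by (rule AE_lborel_singleton)
  ultimately have "AE \<gamma> in lborel. Q \<gamma> * cnj (rep_l2 (fourier f) \<gamma>) = 0"
    using f h0
  proof eventually_elim
    case (elim \<gamma>)
    show ?case
    proof (cases "r * c \<le> \<bar>\<gamma>\<bar>")
      case True
      then show ?thesis using elim by (simp add: c_def)
    next
      case False
      then have "\<bar>0 + 1 / c * \<gamma>\<bar> < r" "0 < \<bar>0 + 1 / c * \<gamma>\<bar>"
        using c elim(2) by (simp_all add: abs_mult field_simps)
      then show ?thesis
        using elim(1,4) by (simp add: h_def)
    qed
  qed
  then have "cinner (fourier q) (fourier f) = 0"
    unfolding cinner_rep_l2 Q_def by (rule integral_eq_zero_AE)
  then have "inner q f = 0" "inner q p = 0"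
    using q[OF p(1)] by (simp_all add: unit inner_eq_Re_cinner)
  then have "inner q q = 0"
    by (simp add: q_def inner_diff_right)
  then show ?thesis
    using p(1) by (simp add: q_def)
qed

section \<open>Decomposition over a measurable partition, and one expansion for all weavings\<close>

section \<open>Band decomposition\<close>

text \<open>The sum over a finite \<open>K\<close> is \<open>g\<close> restricted to the points with
  \<open>\<kappa> x \<in> K\<close>. Once \<open>K\<close> contains \<open>{- int n..int n}\<close>,
  the squared error is at most the tail \<open>T n\<close>, whatever else \<open>K\<close> contains;
  this gives unconditional convergence.\<close>

lemma has_sum_l2_partition:
  fixes \<kappa> :: "real \<Rightarrow> int"
  assumes [measurable]: "\<kappa> \<in> borel \<rightarrow>\<^sub>M count_space UNIV" and g: "square_integrable g"
  shows "\<And>i. square_integrable (\<lambda>x. if \<kappa> x = i then g x else 0)"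
    and "((\<lambda>i. abs_l2 (\<lambda>x. if \<kappa> x = i then g x else 0)) has_sum abs_l2 g) UNIV"
proof -
  have [measurable]: "g \<in> borel_measurable borel"
    using g by (rule square_integrable_measurable)
  have intg: "integrable lborel (\<lambda>x. (cmod (g x))\<^sup>2)"
    using g by (simp add: square_integrable_def)
  have sq: "square_integrable (\<lambda>x. if \<kappa> x \<in> K then g x else 0)" for K
    unfolding square_integrable_def
    by (intro conjI Bochner_Integration.integrable_bound[OF intg]) auto
  from sq[of "{_}"] show sq1: "square_integrable (\<lambda>x. if \<kappa> x = i then g x else 0)" for i
    by simp
  have sum: "(\<Sum>i\<in>K. abs_l2 (\<lambda>x. if \<kappa> x = i then g x else 0)) = abs_l2 (\<lambda>x. if \<kappa> x \<in> K then g x else 0)"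
    if "finite K" for K
    using that
  proof (induction K)
    case empty
    then show ?case by (simp add: zero_l2_def)
  next
    case (insert i K)
    have "(if \<kappa> x = i then g x else 0) + (if \<kappa> x \<in> K then g x else 0) = (if \<kappa> x \<in> insert i K then g x else 0)" for x
      using insert by auto
    then show ?case
      using insert by (simp add: plus_abs_l2 sq sq1)
  qed
  \<comment> \<open>The squared norm of \<open>g\<close> outside the pieces from \<open>- n\<close>
    to \<open>n\<close>; it tends to 0 by dominated convergence, as each point lies in one
    piece.\<close>
  define T where "T n = (\<integral>x. (if \<kappa> x \<in> {- int n..int n} then 0 else (cmod (g x))\<^sup>2) \<partial>lborel)" for n
  have T: "T \<longlonglongrightarrow> (\<integral>x. 0 \<partial>(lborel :: real measure))"
    unfolding T_def
  proof (rule integral_dominated_convergence[OF _ _ intg])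
    show "AE x in lborel. (\<lambda>n. if \<kappa> x \<in> {- int n..int n} then 0 else (cmod (g x))\<^sup>2) \<longlonglongrightarrow> 0"
    proof (intro always_eventually allI)
      fix x
      have "\<forall>\<^sub>F n in sequentially. 0 = (if \<kappa> x \<in> {- int n..int n} then 0 else (cmod (g x))\<^sup>2)"
        using eventually_ge_at_top[of "nat \<bar>\<kappa> x\<bar>"] by eventually_elim auto
      then show "(\<lambda>n. if \<kappa> x \<in> {- int n..int n} then 0 else (cmod (g x))\<^sup>2) \<longlonglongrightarrow> 0"
        by (rule Lim_transform_eventually[OF tendsto_const])
    qed
  qed auto
  show "((\<lambda>i. abs_l2 (\<lambda>x. if \<kappa> x = i then g x else 0)) has_sum abs_l2 g) UNIV"
    unfolding has_sum_def
  proof (rule tendstoI)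
    fix e :: real assume e: "e > 0"
    then have "\<forall>\<^sub>F n in sequentially. T n < e\<^sup>2"
      using T by (intro order_tendstoD(2)[of T]) auto
    then obtain n where n: "T n < e\<^sup>2"
      by (auto simp: eventually_sequentially)
    show "\<forall>\<^sub>F K in finite_subsets_at_top UNIV.
        dist (\<Sum>i\<in>K. abs_l2 (\<lambda>x. if \<kappa> x = i then g x else 0)) (abs_l2 g) < e"
      unfolding eventually_finite_subsets_at_top
    proof (intro exI[of _ "{- int n..int n}"] conjI allI impI)
      fix K assume K: "finite K \<and> {- int n..int n} \<subseteq> K \<and> K \<subseteq> UNIV"
      then have "dist (\<Sum>i\<in>K. abs_l2 (\<lambda>x. if \<kappa> x = i then g x else 0)) (abs_l2 g)
          = norm (abs_l2 (\<lambda>x. (if \<kappa> x \<in> K then g x else 0) - g x))"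
        by (simp add: sum dist_norm minus_abs_l2 sq g)
      also have "\<dots> = sqrt (\<integral>x. (cmod ((if \<kappa> x \<in> K then g x else 0) - g x))\<^sup>2 \<partial>lborel)"
        by (intro norm_abs_l2 square_integrable_diff sq g)
      also have "\<dots> \<le> sqrt (T n)"
        unfolding T_def
      proof (intro real_sqrt_le_mono integral_mono)
        show "integrable lborel (\<lambda>x. (cmod ((if \<kappa> x \<in> K then g x else 0) - g x))\<^sup>2)"
          using square_integrable_diff[OF sq g] by (simp add: square_integrable_def)
        show "integrable lborel (\<lambda>x. if \<kappa> x \<in> {- int n..int n} then 0 else (cmod (g x))\<^sup>2)"
          by (rule Bochner_Integration.integrable_bound[OF intg]) auto
      qed (use K in auto)
      also have "\<dots> < e"
        using real_sqrt_less_mono[OF n] e by simp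
      finally show "dist (\<Sum>i\<in>K. abs_l2 (\<lambda>x. if \<kappa> x = i then g x else 0)) (abs_l2 g) < e" .
    qed simp_all
  qed
qed

text \<open>An expansion whose term at \<open>j\<close> lies in every \<open>W l j\<close> at once
  serves every partition; only the index set changes.\<close>

lemma wovenI:
  fixes W :: "nat \<Rightarrow> 'j \<Rightarrow> 'h::complex_hilbert set"
  assumes W: "\<And>l j. csubspace (W l j)" "\<And>l j. closed (W l j)"
    and expansion: "\<And>f. \<exists>g. (g has_sum f) J \<and> (\<forall>j\<in>J. \<forall>l\<in>{1..N}. g j \<in> W l j)"
  shows "woven N J W"
  unfolding woven_def
proof (intro conjI ballI allI impI)
  fix l assume "l \<in> {1..N}"
  then show "information_packet J (W l)"
    unfolding information_packet_def using W expansion by blast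
next
  fix \<sigma> :: "nat \<Rightarrow> 'j set" assume \<sigma>: "(\<Union>k\<in>{1..N}. \<sigma> k) = J \<and> disjoint_family_on \<sigma> {1..N}"
  let ?J = "SIGMA k:{1..N}. \<sigma> k"
  \<comment> \<open>The parts are disjoint and cover \<open>J\<close>, so each \<open>j\<close>
    occurs in exactly one pair and the sum over pairs is a reindexing.\<close>
  have bij: "bij_betw snd ?J J"
    unfolding bij_betw_def
  proof
    show "inj_on snd ?J"
    proof (rule inj_onI)
      fix p p' assume p: "p \<in> ?J" "p' \<in> ?J" "snd p = snd p'"
      then have "fst p \<in> {1..N}" "fst p' \<in> {1..N}" "snd p \<in> \<sigma> (fst p) \<inter> \<sigma> (fst p')"
        by auto
      then have "fst p = fst p'"
        using \<sigma> unfolding disjoint_family_on_def by blast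
      then show "p = p'"
        using p(3) by (rule prod_eqI)
    qed
    show "snd ` ?J = J"
      using \<sigma> by (simp add: snd_image_Sigma)
  qed
  have "\<exists>g. (\<forall>p\<in>?J. g p \<in> (case p of (k, j) \<Rightarrow> W k j)) \<and> (g has_sum f) ?J" for f
  proof -
    obtain g where g: "(g has_sum f) J" "\<forall>j\<in>J. \<forall>l\<in>{1..N}. g j \<in> W l j"
      using expansion by blast
    have "((\<lambda>p. g (snd p)) has_sum f) ?J"
      using has_sum_reindex_bij_betw[OF bij] g(1) by blast
    moreover have "\<forall>p\<in>?J. g (snd p) \<in> (case p of (k, j) \<Rightarrow> W k j)"
      using g(2) \<sigma> by auto
    ultimately show ?thesis
      by (intro exI[of _ "\<lambda>p. g (snd p)"] conjI)
  qed
  then show "information_packet ?J (\<lambda>(k, j). W k j)"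
    unfolding information_packet_def using W by auto
qed

theorem theorem3p3:
  fixes \<psi> :: l2 and I U :: "real set"
    and C D \<alpha> \<beta> a b :: real and N :: nat
  assumes bounded: "\<exists>M. AE \<gamma> in lborel. cmod (rep_l2 (fourier \<psi>) \<gamma>) \<le> M"
    and compact_supp: "compact (essential_support (rep_l2 (fourier \<psi>)))"
    and I: "is_interval I" "bounded I"
    and supp: "essential_support (rep_l2 (fourier \<psi>)) \<subseteq> I"
    and pos: "C > 0" "D > 0" "\<alpha> > 0" "\<beta> > 0"
    and nhd: "0 \<in> interior U"
    and bounds: "AE \<gamma> in lborel. \<gamma> \<in> U \<longrightarrow>
      C * \<bar>\<gamma>\<bar> powr \<beta> \<le> cmod (rep_l2 (fourier \<psi>) \<gamma>) \<and>
      cmod (rep_l2 (fourier \<psi>) \<gamma>) \<le> D * \<bar>\<gamma>\<bar> powr \<alpha>"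
    and a: "a > 1"
    and b: "0 < b" "b \<le> inverse (measure lborel I)"
    and N: "N \<ge> 1"
  shows "woven N (UNIV :: int set) (\<lambda>l j. wavelet_space a b \<psi> (int N * j + int l - 1))"
proof (rule wovenI)
  show "csubspace (wavelet_space a b \<psi> j)" "closed (wavelet_space a b \<psi> j)" for j
    by (simp_all add: wavelet_space_def csubspace_closure)
  \<comment> \<open>Since \<open>inverse 0 = 0\<close>, an interval of measure 0 would contradict
    \<open>0 < b\<close>.\<close>
  have m: "measure lborel I > 0"
  proof (rule ccontr)
    assume "\<not> measure lborel I > 0"
    then have "measure lborel I = 0"
      using measure_nonneg[of lborel I] by linarith
    then show False
      using b by simp
  qed
  obtain s where s: "I \<subseteq> {s..s + measure lborel I}"
    using bounded_interval_subset_Icc_measure[OF I m] .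
  have bm: "b * measure lborel I \<le> 1"
    using mult_right_mono[OF b(2), of "measure lborel I"] m by simp
  obtain r where r: "r > 0" "ball 0 r \<subseteq> U"
    using nhd unfolding mem_interior by blast
  \<comment> \<open>The lower bound is positive except at 0, where
    \<open>0 powr \<beta> = 0\<close>.\<close>
  have nz: "AE \<gamma> in lborel. 0 < \<bar>\<gamma>\<bar> \<and> \<bar>\<gamma>\<bar> < r \<longrightarrow> rep_l2 (fourier \<psi>) \<gamma> \<noteq> 0"
    using bounds
  proof eventually_elim
    case (elim \<gamma>)
    show ?case
    proof
      assume \<gamma>: "0 < \<bar>\<gamma>\<bar> \<and> \<bar>\<gamma>\<bar> < r"
      then have "C * \<bar>\<gamma>\<bar> powr \<beta> \<le> cmod (rep_l2 (fourier \<psi>) \<gamma>)"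
        using elim r(2) by (auto simp: subset_eq)
      moreover have "0 < C * \<bar>\<gamma>\<bar> powr \<beta>"
        using pos \<gamma> by simp
      ultimately show "rep_l2 (fourier \<psi>) \<gamma> \<noteq> 0"
        by auto
    qed
  qed
  \<comment> \<open>The ratio of scales between consecutive indices of one packet.\<close>
  define q where "q = a ^ N"
  have q: "q > 1"
    unfolding q_def using a N by (simp add: one_less_power)
  \<comment> \<open>Away from 0, \<open>\<kappa> \<gamma> = i\<close> describes the annulus
    \<open>r * q powi (i - 1) \<le> \<bar>\<gamma>\<bar> < r * q powi i\<close>; adding 1 to the
    floor gives the strict upper bound.\<close>
  define \<kappa> where "\<kappa> \<gamma> = \<lfloor>log q (\<bar>\<gamma>\<bar> / r)\<rfloor> + 1" for \<gamma>
  have [measurable]: "\<kappa> \<in> borel \<rightarrow>\<^sub>M count_space UNIV"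
    unfolding \<kappa>_def by measurable
  have \<kappa>: "\<bar>\<gamma>\<bar> < r * q powi \<kappa> \<gamma>" if "\<gamma> \<noteq> 0" for \<gamma>
  proof -
    have "log q (\<bar>\<gamma>\<bar> / r) < of_int (\<kappa> \<gamma>)"
      unfolding \<kappa>_def by linarith
    then have "\<bar>\<gamma>\<bar> / r < q powr of_int (\<kappa> \<gamma>)"
      using q r that by (subst (asm) log_less_iff) auto
    then show ?thesis
      using q r by (simp add: powr_real_of_int' field_simps)
  qed
  fix f :: l2
  define E where "E i = (\<lambda>\<gamma>. if \<kappa> \<gamma> = i then rep_l2 (fourier f) \<gamma> else 0)" for i
  have E: "square_integrable (E i)" for i
    unfolding E_def by (intro has_sum_l2_partition(1) square_integrable_rep) measurable
  have sum_E: "((\<lambda>i. abs_l2 (E i)) has_sum abs_l2 (rep_l2 (fourier f))) UNIV"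
    unfolding E_def by (intro has_sum_l2_partition(2) square_integrable_rep) measurable
  \<comment> \<open>Surjectivity pulls each band of the transform back to a term \<open>g i\<close>;
    the isometry then carries the convergence back.\<close>
  have "\<exists>x. fourier x = abs_l2 (E i)" for i
    using unitary_fourier unfolding unitary_def by (metis surjD)
  then obtain g where g: "\<And>i. fourier (g i) = abs_l2 (E i)"
    by metis
  interpret F: Vector_Spaces.linear scaleC scaleC fourier
    using unitary_fourier by (simp add: unitary_def)
  have dist: "dist (fourier x) (fourier y) = dist x y" for x y
    using unitary_fourier
    by (simp add: unitary_def dist_norm norm_eq_sqrt_inner inner_eq_Re_cinner flip: F.diff)
  have "(g has_sum f) UNIV"
    using sum_E unfolding has_sum_def abs_rep_l2
    by (subst (asm) tendsto_dist_iff, subst tendsto_dist_iff)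
      (simp add: g[symmetric] dist flip: F.sum)
  moreover have "g i \<in> wavelet_space a b \<psi> (int N * i + int l - 1)" if "l \<in> {1..N}" for i l
  proof (rule band_limited_in_wavelet_space[OF s supp b(1) bm _ nz])
    \<comment> \<open>The offset \<open>l - 1\<close> is nonnegative and \<open>a > 1\<close>, so
      band \<open>i\<close> fits into the space for every \<open>l\<close>, and the same
      \<open>g i\<close> serves all packets.\<close>
    have le: "q powi i \<le> a powi (int N * i + int l - 1)"
    proof -
      have "q powi i = a powi (int N * i)"
        by (simp add: q_def power_int_mult)
      also have "\<dots> \<le> a powi (int N * i + int l - 1)"
        using a that by (intro power_int_increasing) auto
      finally show ?thesis .
    qed
    have "AE \<gamma> in lborel. \<gamma> \<noteq> (0::real)"
      by (rule AE_lborel_singleton)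
    then show "AE \<gamma> in lborel. r * a powi (int N * i + int l - 1) \<le> \<bar>\<gamma>\<bar> \<longrightarrow> rep_l2 (fourier (g i)) \<gamma> = 0"
      using rep_abs_l2[OF E[of i], folded g]
    proof eventually_elim
      case (elim \<gamma>)
      have "r * q powi i \<le> r * a powi (int N * i + int l - 1)"
        using le r by simp
      then show ?case
        using \<kappa>[OF elim(1)] elim(2) by (auto simp: E_def)
    qed
  qed (use a in simp)
  ultimately show "\<exists>g. (g has_sum f) UNIV \<and> (\<forall>j\<in>UNIV. \<forall>l\<in>{1..N}. g j \<in> wavelet_space a b \<psi> (int N * j + int l - 1))"
    by blast
qed

end
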